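(* Let $Z$ be an $H$-valued Lévy process such that for each $t\ge0$ the random variable $Z(t)$ is infinitely divisible with Lévy characteristics $[ta,t\Theta,tM]$, where $a\in H$, $\Theta$ is a nonnegative symmetric trace-class operator on $H$ and $M$ is a Lévy measure on $H\setminus\{0\}$. Let $\{\mathcal R(t)\}_{t\ge0}$ be the resolvent family of the Volterra equation $X(t)=\int_0^t a(t-\tau)AX(\tau)\,d\tau+X_0+Z(t)$. Then for each $t\ge0$ the stochastic convolution $Z_{\mathcal R}(t)=\int_0^t\mathcal R(t-\tau)\,dZ(\tau)$ is infinitely divisible with Lévy characteristics $[\alpha,Q,\mathcal M]$, where $$\alpha=\int_0^t\mathcal R(t-\tau)a\,d\tau+\int_0^t\!\!\int_H \mathcal R(t-\tau)x\,\big[\mathbf 1_{\{|\mathcal R(t-\tau)x|_H<1\}}-\mathbf 1_{\{|x|_H<1\}}\big]\,M(dx)\,d\tau,$$ $$Q=\int_0^t\mathcal R(t-\tau)\,\Theta\,\mathcal R^*(t-\tau)\,d\tau,\qquad \mathcal M(B)=\int_0^t M\big(\{x\in H:\ \mathcal R(t-\tau)x\in B\}\big)\,d\tau$$ for Borel sets $B\subset H\setminus\{0\}$.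
   Context: $H$ is a real separable Hilbert space with inner product $\langle\cdot,\cdot\rangle_H$ and norm $|\cdot|_H$. $A$ is a closed linear operator in $H$ with dense domain $\mathcal D(A)$, $a\in L^1_{\mathrm{loc}}(\mathbb R_+)$ (the kernel; not to be confused with the drift vector $a\in H$ above — the kernel appears only in the equation), and the equation is assumed well-posed with resolvent family $\{\mathcal R(t)\}_{t\ge0}$ of bounded operators, uniformly bounded on compact intervals, strongly continuous, $\mathcal R(0)=I$, satisfying $\mathcal R(t)x=x+\int_0^t a(t-\tau)A\mathcal R(\tau)x\,d\tau$ for $x\in\mathcal D(A)$. An $H$-valued Lévy process is a process with independent stationary increments, continuous in probability, càdlàg, with $Z(0)=0$. The stochastic convolution $\int_0^t\mathcal R(t-\tau)\,dZ(\tau)$ is defined as the limit in probability of $\sum_i\mathcal R(s_i)(Z(t-t_{i-1})-Z(t-t_i))$ over partitions $0=t_0<\dots<t_n=t$ with mesh $\to0$, $s_i\in[t_{i-1},t_i]$. Lévy characteristics $[\alpha,Q,\mathcal M]$ of an infinitely divisible $H$-valued random variable $Y$ mean $\mathbb E e^{i\langle y,Y\rangle_H}=\exp\big(i\langle\alpha,y\rangle_H-\tfrac12\langle Qy,y\rangle_H+\int_H(e^{i\langle y,x\rangle_H}-1-i\langle y,x\rangle_H\mathbf 1_{\{|x|_H<1\}})\mathcal M(dx)\big)$, $y\in H$. *)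

theory Defs
  imports "HOL-Probability.Probability"
begin

definition hadj :: "('h::real_inner \<Rightarrow> 'h) \<Rightarrow> 'h \<Rightarrow> 'h" where
  "hadj T y = (THE z. \<forall>x. inner (T x) y = inner x z)"

definition orthonormal_basis :: "'h::real_inner set \<Rightarrow> bool" where
  "orthonormal_basis B \<longleftrightarrow> (\<forall>e\<in>B. norm e = 1) \<and> (\<forall>e\<in>B. \<forall>f\<in>B. e \<noteq> f \<longrightarrow> inner e f = 0)
     \<and> closure (span B) = UNIV"

definition nonneg_sym_trace_class :: "('h::real_inner \<Rightarrow> 'h) \<Rightarrow> bool" where
  "nonneg_sym_trace_class T \<longleftrightarrow> bounded_linear T \<and> (\<forall>x y. inner (T x) y = inner x (T y))
     \<and> (\<forall>x. inner (T x) x \<ge> 0) \<and> (\<exists>B. orthonormal_basis B \<and> (\<lambda>e. inner (T e) e) summable_on B)"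

definition closed_dense_op :: "('h::real_normed_vector \<Rightarrow> 'h) \<Rightarrow> 'h set \<Rightarrow> bool" where
  "closed_dense_op A D \<longleftrightarrow> subspace D \<and> closure D = UNIV
     \<and> (\<forall>x\<in>D. \<forall>y\<in>D. A (x + y) = A x + A y) \<and> (\<forall>c. \<forall>x\<in>D. A (c *\<^sub>R x) = c *\<^sub>R A x)
     \<and> (\<forall>xs x y. (\<forall>n. xs n \<in> D) \<longrightarrow> xs \<longlonglongrightarrow> x \<longrightarrow> (\<lambda>n. A (xs n)) \<longlonglongrightarrow> y \<longrightarrow> x \<in> D \<and> A x = y)"

definition resolvent_family ::
  "(real \<Rightarrow> real) \<Rightarrow> ('h::{real_inner,complete_space,second_countable_topology} \<Rightarrow> 'h) \<Rightarrow> 'h set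
     \<Rightarrow> (real \<Rightarrow> 'h \<Rightarrow> 'h) \<Rightarrow> bool" where
  "resolvent_family k A D R \<longleftrightarrow>
     (\<forall>t\<ge>0. bounded_linear (R t))
   \<and> (\<forall>T\<ge>0. \<exists>C. \<forall>t\<in>{0..T}. \<forall>x. norm (R t x) \<le> C * norm x)
   \<and> (\<forall>x. continuous_on {0..} (\<lambda>t. R t x))
   \<and> (\<forall>x. R 0 x = x)
   \<and> (\<forall>x\<in>D. \<forall>t\<ge>0. (\<forall>s\<in>{0..t}. R s x \<in> D)
        \<and> set_integrable lborel {0..t} (\<lambda>s. k (t - s) *\<^sub>R A (R s x))
        \<and> R t x = x + (LINT s:{0..t}|lborel. k (t - s) *\<^sub>R A (R s x)))"

definition cadlag :: "(real \<Rightarrow> 'h::metric_space) \<Rightarrow> bool" where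
  "cadlag f \<longleftrightarrow> (\<forall>t\<ge>0. continuous (at_right t) f \<and> (t > 0 \<longrightarrow> (\<exists>l. (f \<longlongrightarrow> l) (at_left t))))"

definition levy_process ::
  "'a measure \<Rightarrow> (real \<Rightarrow> 'a \<Rightarrow> 'h::{real_inner,complete_space,second_countable_topology}) \<Rightarrow> bool" where
  "levy_process P Z \<longleftrightarrow> prob_space P
   \<and> (\<forall>t\<ge>0. Z t \<in> borel_measurable P)
   \<and> (\<forall>\<omega>\<in>space P. Z 0 \<omega> = 0)
   \<and> (\<forall>n (ts::nat \<Rightarrow> real). 0 \<le> ts 0 \<and> (\<forall>i<n. ts i < ts (Suc i)) \<longrightarrow>
        prob_space.indep_vars P (\<lambda>_. borel) (\<lambda>i \<omega>. Z (ts (Suc i)) \<omega> - Z (ts i) \<omega>) {..<n})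
   \<and> (\<forall>s\<ge>0. \<forall>t\<ge>0. distr P borel (\<lambda>\<omega>. Z (s + t) \<omega> - Z s \<omega>) = distr P borel (Z t))
   \<and> (\<forall>t\<ge>0. \<forall>e>0. ((\<lambda>s. measure P {\<omega>\<in>space P. dist (Z s \<omega>) (Z t \<omega>) > e}) \<longlongrightarrow> 0) (at t within {0..}))
   \<and> (\<forall>\<omega>\<in>space P. cadlag (\<lambda>t. Z t \<omega>))"

definition mconv :: "'h::{real_normed_vector,second_countable_topology} measure \<Rightarrow> 'h measure \<Rightarrow> 'h measure" where
  "mconv \<mu> \<nu> = distr (\<mu> \<Otimes>\<^sub>M \<nu>) borel (\<lambda>(x, y). x + y)"

fun mconv_pow :: "'h::{real_normed_vector,second_countable_topology} measure \<Rightarrow> nat \<Rightarrow> 'h measure" where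
  "mconv_pow \<mu> 0 = return borel 0"
| "mconv_pow \<mu> (Suc n) = mconv \<mu> (mconv_pow \<mu> n)"

definition infinitely_divisible ::
  "'a measure \<Rightarrow> ('a \<Rightarrow> 'h::{real_normed_vector,second_countable_topology}) \<Rightarrow> bool" where
  "infinitely_divisible P Y \<longleftrightarrow> (\<forall>n\<ge>1. \<exists>\<mu>. prob_space \<mu> \<and> sets \<mu> = sets borel
      \<and> distr P borel Y = mconv_pow \<mu> n)"

definition levy_measure :: "'h::real_normed_vector measure \<Rightarrow> bool" where
  "levy_measure M \<longleftrightarrow> sets M = sets borel \<and> emeasure M {0} = 0
     \<and> (\<integral>\<^sup>+x. ennreal (min 1 ((norm x)\<^sup>2)) \<partial>M) < \<infinity>"

definition levy_char ::
  "'a measure \<Rightarrow> ('a \<Rightarrow> 'h::{real_inner,complete_space,second_countable_topology}) \<Rightarrow> 'h \<Rightarrow> ('h \<Rightarrow> 'h)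
     \<Rightarrow> 'h measure \<Rightarrow> bool" where
  "levy_char P Y \<alpha> Q MM \<longleftrightarrow> (\<forall>y.
     (LINT \<omega>|P. exp (\<i> * complex_of_real (inner y (Y \<omega>)))) =
     exp (\<i> * complex_of_real (inner \<alpha> y) - complex_of_real (inner (Q y) y / 2)
          + (LINT x|MM. exp (\<i> * complex_of_real (inner y x)) - 1
                - \<i> * complex_of_real (inner y x) * complex_of_real (indicator {x. norm x < 1} x))))"

definition tagged_partition :: "real \<Rightarrow> real \<Rightarrow> nat \<Rightarrow> (nat \<Rightarrow> real) \<Rightarrow> (nat \<Rightarrow> real) \<Rightarrow> bool" where
  "tagged_partition t \<delta> n ts ss \<longleftrightarrow> n \<ge> 1 \<and> ts 0 = 0 \<and> ts n = t \<and> (\<forall>i<n. ts i < ts (Suc i))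
     \<and> (\<forall>i\<in>{1..n}. ts (i - 1) \<le> ss i \<and> ss i \<le> ts i \<and> ts i - ts (i - 1) < \<delta>)"

definition conv_sum ::
  "(real \<Rightarrow> 'h \<Rightarrow> 'h::real_normed_vector) \<Rightarrow> (real \<Rightarrow> 'a \<Rightarrow> 'h) \<Rightarrow> real \<Rightarrow> nat \<Rightarrow> (nat \<Rightarrow> real)
     \<Rightarrow> (nat \<Rightarrow> real) \<Rightarrow> 'a \<Rightarrow> 'h" where
  "conv_sum R Z t n ts ss \<omega> = (\<Sum>i\<in>{1..n}. R (ss i) (Z (t - ts (i - 1)) \<omega> - Z (t - ts i) \<omega>))"

text \<open>Y is the stochastic convolution int_0^t R(t-s) dZ(s): the limit in probability of the
  Riemann sums as the mesh tends to 0 (for t = 0 the empty integral, i.e. 0).\<close>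
definition is_stoch_conv ::
  "'a measure \<Rightarrow> (real \<Rightarrow> 'h \<Rightarrow> 'h::real_normed_vector) \<Rightarrow> (real \<Rightarrow> 'a \<Rightarrow> 'h) \<Rightarrow> real \<Rightarrow> ('a \<Rightarrow> 'h) \<Rightarrow> bool" where
  "is_stoch_conv P R Z t Y \<longleftrightarrow>
     (if t = 0 then (AE \<omega> in P. Y \<omega> = 0)
      else (\<forall>e>0. \<exists>\<delta>>0. \<forall>n ts ss. tagged_partition t \<delta> n ts ss \<longrightarrow>
              measure P {\<omega>\<in>space P. dist (conv_sum R Z t n ts ss \<omega>) (Y \<omega>) > e} < e))"

end

theory Submission
  imports Defs
begin

text \<open>
  Let \<open>\<psi>\<close> be the Levy exponent of \<open>Z 1\<close>, and consider the Riemann sums of the convolution over dyadic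
  partitions. By independence and stationarity of the increments, the characteristic functional of such
  a sum at \<open>y\<close> is \<open>exp\<close> of a Riemann sum of \<open>s \<mapsto> \<psi> (R(t - s)\<^sup>* y)\<close>. The path \<open>s \<mapsto> R(t - s)\<^sup>* y\<close> is only
  weakly continuous, but \<open>\<psi>\<close> is weakly sequentially continuous, so that in the limit
  \<open>E exp (i \<langle>y, Y\<rangle>) = exp (\<integral>\<^sub>0\<^sup>t \<psi> (R(t - s)\<^sup>* y) ds)\<close>. Fubini's theorem turns the exponent into the claimed
  triplet; the second term of the drift compensates the change of the truncation function from
  \<open>|x| < 1\<close> to \<open>|R(t - s) x| < 1\<close>.

  For infinite divisibility, slow the process down to \<open>Z(s/n)\<close>. A Riemann sum of \<open>Z\<close> is distributed as a
  sum of \<open>n\<close> independent copies of the corresponding sum of \<open>Z(s/n)\<close>. If a sum of \<open>n\<close> independent copies is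
  small in probability, then so is each of them; hence the sums of \<open>Z(s/n)\<close> are Cauchy in probability,
  and the law of their limit is an \<open>n\<close>-th convolution root of the law of \<open>Y\<close>.
\<close>

section \<open>Hilbert spaces\<close>

lemma CauchyI_dist_le_add:
  fixes X :: "nat \<Rightarrow> 'a::metric_space"
  assumes dist_le: "\<And>i j. dist (X i) (X j) \<le> e i + e j" and lim: "e \<longlonglongrightarrow> 0"
  shows "Cauchy X"
proof (rule metric_CauchyI)
  fix \<epsilon> :: real assume "0 < \<epsilon>"
  then obtain N where N: "\<And>n. n \<ge> N \<Longrightarrow> e n < \<epsilon> / 2"
    using order_tendstoD(2)[OF lim, of "\<epsilon> / 2"] by (auto simp: eventually_sequentially)
  show "\<exists>N. \<forall>i\<ge>N. \<forall>j\<ge>N. dist (X i) (X j) < \<epsilon>"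
  proof (intro exI[of _ N] allI impI)
    fix i j assume "i \<ge> N" "j \<ge> N"
    then show "dist (X i) (X j) < \<epsilon>" using N[of i] N[of j] dist_le[of i j] by linarith
  qed
qed

lemma convex_norm_diff_le:
  fixes x y :: "'h::real_inner"
  assumes "convex S" "x \<in> S" "y \<in> S" and lower: "\<And>w. w \<in> S \<Longrightarrow> m \<le> (norm w)\<^sup>2"
  shows "(norm (x - y))\<^sup>2 \<le> 2 * ((norm x)\<^sup>2 - m) + 2 * ((norm y)\<^sup>2 - m)"
proof -
  have "(1/2) *\<^sub>R x + (1/2) *\<^sub>R y \<in> S" using assms by (intro convexD) auto
  from lower[OF this] have "4 * m \<le> (norm (x + y))\<^sup>2"
    by (simp add: power2_eq_square flip: scaleR_add_right)
  moreover have "(norm (x - y))\<^sup>2 = 2 * (norm x)\<^sup>2 + 2 * (norm y)\<^sup>2 - (norm (x + y))\<^sup>2"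
    by (simp add: power2_norm_eq_inner inner_add inner_diff inner_commute)
  ultimately show ?thesis by simp
qed

lemma closed_convex_norm_minimizer:
  fixes S :: "'h::{real_inner,complete_space} set"
  assumes S: "closed S" "convex S" "S \<noteq> {}"
  obtains z where "z \<in> S" "\<And>x. x \<in> S \<Longrightarrow> norm z \<le> norm x"
proof -
  define m where "m = (INF x\<in>S. (norm x)\<^sup>2)"
  have m_le: "m \<le> (norm x)\<^sup>2" if "x \<in> S" for x
    unfolding m_def using that by (intro cINF_lower bdd_belowI2[of _ 0]) auto
  have "\<exists>x\<in>S. (norm x)\<^sup>2 < m + 1 / real (Suc n)" for n
    using cInf_lessD[of "(\<lambda>x. (norm x)\<^sup>2) ` S" "m + 1 / real (Suc n)"] S(3) by (auto simp: m_def)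
  then obtain X where X: "\<And>n. X n \<in> S" "\<And>n. (norm (X n))\<^sup>2 < m + 1 / real (Suc n)" by metis
  define e where "e n = sqrt (2 * (1 / real (Suc n)))" for n
  have "Cauchy X"
  proof (rule CauchyI_dist_le_add[where e=e])
    fix i j
    have "(norm (X i - X j))\<^sup>2 \<le> 2 * ((norm (X i))\<^sup>2 - m) + 2 * ((norm (X j))\<^sup>2 - m)"
      using S(2) X(1) X(1) m_le by (rule convex_norm_diff_le)
    also have "\<dots> \<le> 2 * (1 / real (Suc i)) + 2 * (1 / real (Suc j))"
      using less_imp_le[OF X(2)]
      by (intro add_mono mult_left_mono) (simp_all add: diff_le_eq add.commute)
    finally have "norm (X i - X j) \<le> sqrt (2 * (1 / real (Suc i)) + 2 * (1 / real (Suc j)))"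
      by (rule real_le_rsqrt)
    also have "\<dots> \<le> e i + e j" unfolding e_def by (rule sqrt_add_le_add_sqrt) auto
    finally show "dist (X i) (X j) \<le> e i + e j" by (simp add: dist_norm)
    have "e \<longlonglongrightarrow> sqrt (2 * 0)"
      unfolding e_def by (intro tendsto_intros LIMSEQ_Suc[OF lim_1_over_n])
    then show "e \<longlonglongrightarrow> 0" by simp
  qed
  then obtain z where z: "X \<longlonglongrightarrow> z" using Cauchy_convergent convergent_def by blast
  show thesis
  proof (rule that)
    show "z \<in> S" using S(1) X(1) z by (rule closed_sequentially)
    have "(norm z)\<^sup>2 \<le> m"
    proof (rule LIMSEQ_le)
      show "(\<lambda>n. (norm (X n))\<^sup>2) \<longlonglongrightarrow> (norm z)\<^sup>2" by (intro tendsto_intros z)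
      show "(\<lambda>n. m + 1 / real (Suc n)) \<longlonglongrightarrow> m"
        using tendsto_add[OF tendsto_const LIMSEQ_Suc[OF lim_1_over_n], of m] by simp
      show "\<exists>N. \<forall>n\<ge>N. (norm (X n))\<^sup>2 \<le> m + 1 / real (Suc n)" using X(2) less_imp_le by blast
    qed
    then show "norm z \<le> norm x" if "x \<in> S" for x
      using m_le[OF that] by (auto intro: power2_le_imp_le[OF order_trans])
  qed
qed

lemma inner_eq_zero_of_norm_le:
  fixes z v :: "'h::real_inner"
  assumes "\<And>c. norm z \<le> norm (z + c *\<^sub>R v)"
  shows "inner z v = 0"
proof (cases "v = 0")
  case False
  define c where "c = - inner z v / (norm v)\<^sup>2"
  have "(norm z)\<^sup>2 \<le> (norm (z + c *\<^sub>R v))\<^sup>2" using assms by (intro power_mono) auto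
  also have "\<dots> = (norm z)\<^sup>2 + 2 * c * inner z v + c\<^sup>2 * (norm v)\<^sup>2"
    unfolding power2_norm_eq_inner
    by (simp add: inner_add inner_commute power2_eq_square algebra_simps)
  also have "\<dots> = (norm z)\<^sup>2 - (inner z v)\<^sup>2 / (norm v)\<^sup>2"
    using False by (simp add: c_def power2_eq_square field_simps)
  finally have "(inner z v)\<^sup>2 / (norm v)\<^sup>2 \<le> 0" by simp
  then show ?thesis using False by (simp add: divide_le_0_iff)
qed simp

text \<open>The representing vector is a multiple of the point of \<open>{x. f x = 1}\<close> closest to the origin.\<close>
lemma riesz_representation:
  fixes f :: "'h::{real_inner,complete_space} \<Rightarrow> real"
  assumes f: "bounded_linear f"
  obtains z where "\<And>x. f x = inner x z"
proof (cases "\<forall>x. f x = 0")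
  case True
  then show thesis using that[of 0] by simp
next
  case False
  interpret f: bounded_linear f by fact
  obtain u where u: "f u \<noteq> 0" using False by blast
  let ?S = "{x. f x = 1}"
  obtain z where z: "f z = 1" and minimal: "\<And>x. f x = 1 \<Longrightarrow> norm z \<le> norm x"
  proof (rule closed_convex_norm_minimizer[of ?S])
    show "closed ?S" by (intro closed_Collect_eq f.continuous_on continuous_intros)
    show "convex ?S" by (auto simp: convex_def f.add f.scaleR simp flip: distrib_right)
    have "(1 / f u) *\<^sub>R u \<in> ?S" using u by (simp add: f.scaleR)
    then show "?S \<noteq> {}" by blast
  qed auto
  have z0: "z \<noteq> 0" using z f.zero by force
  have "f x = inner x ((1 / (norm z)\<^sup>2) *\<^sub>R z)" for x
  proof -
    have "norm z \<le> norm (z + c *\<^sub>R (x - f x *\<^sub>R z))" for c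
      by (rule minimal) (simp add: f.add f.diff f.scaleR z)
    then have "inner z (x - f x *\<^sub>R z) = 0" by (rule inner_eq_zero_of_norm_le)
    then have "inner x z = f x * (norm z)\<^sup>2"
      by (simp add: inner_diff_right power2_norm_eq_inner inner_commute)
    then show ?thesis using z0 by simp
  qed
  then show thesis by (rule that)
qed

lemma inner_hadj:
  fixes T :: "'h::{real_inner,complete_space} \<Rightarrow> 'h"
  assumes "bounded_linear T"
  shows "inner x (hadj T y) = inner (T x) y"
proof -
  have "bounded_linear (\<lambda>x. inner (T x) y)"
    using bounded_linear_compose[OF bounded_linear_inner_left assms] .
  then obtain z where z: "\<And>x. inner (T x) y = inner x z" using riesz_representation by blast
  have "hadj T y = z"
    unfolding hadj_def
  proof (rule the_equality)
    fix w assume "\<forall>x. inner (T x) y = inner x w"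
    then show "w = z" using z by (metis vector_eq_rdot inner_commute)
  qed (simp add: z)
  then show ?thesis using z by simp
qed

lemma inner_hadj_left:
  fixes T :: "'h::{real_inner,complete_space} \<Rightarrow> 'h"
  assumes "bounded_linear T"
  shows "inner (hadj T y) x = inner y (T x)"
  using inner_hadj[OF assms, of x y] by (simp add: inner_commute)

lemma norm_hadj_le:
  fixes T :: "'h::{real_inner,complete_space} \<Rightarrow> 'h"
  assumes T: "bounded_linear T" and bound: "\<And>x. norm (T x) \<le> C * norm x"
  shows "norm (hadj T y) \<le> C * norm y"
proof -
  let ?z = "hadj T y"
  have "norm ?z * norm ?z = inner (T ?z) y"
    by (simp add: power2_norm_eq_inner flip: inner_hadj[OF T] power2_eq_square)
  also have "\<dots> \<le> norm (T ?z) * norm y" by (rule norm_cauchy_schwarz)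
  also have "\<dots> \<le> C * norm ?z * norm y" by (intro mult_right_mono bound) simp
  finally have "norm ?z * norm ?z \<le> norm ?z * (C * norm y)" by (simp add: mult_ac)
  moreover have "0 \<le> C * norm y" using bound[of y] norm_ge_zero[of "T y"] by linarith
  ultimately show ?thesis by (cases "norm ?z = 0") (auto simp: mult_le_cancel_left)
qed

section \<open>Measurability and integrability of Hilbert space valued functions\<close>

lemma borel_measurable_distI:
  fixes f :: "'a \<Rightarrow> 'b::{metric_space,second_countable_topology}"
  assumes [measurable]: "\<And>c. (\<lambda>x. dist c (f x)) \<in> borel_measurable M"
  shows "f \<in> borel_measurable M"
proof (rule borel_measurableI)
  fix U :: "'b set" assume U: "open U"
  let ?balls = "{ball c r |c r. ball c r \<subseteq> U}"
  obtain \<B> where \<B>: "\<B> \<subseteq> ?balls" "countable \<B>" "\<Union>\<B> = \<Union>?balls"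
    using Lindelof[of ?balls] by auto
  have "U = \<Union>?balls"
  proof
    show "U \<subseteq> \<Union>?balls"
    proof
      fix x assume "x \<in> U"
      then obtain r where "0 < r" "ball x r \<subseteq> U" using U openE by blast
      then show "x \<in> \<Union>?balls" using centre_in_ball by blast
    qed
  qed auto
  then have "U = \<Union>\<B>" using \<B>(3) by simp
  then have "f -` U \<inter> space M = (\<Union>B\<in>\<B>. f -` B \<inter> space M)" by auto
  also have "\<dots> \<in> sets M"
  proof (intro sets.countable_UN''[OF \<B>(2)])
    fix B assume "B \<in> \<B>"
    then obtain c r where "B = ball c r" using \<B>(1) by blast
    then have "f -` B \<inter> space M = {x\<in>space M. dist c (f x) < r}" by auto
    then show "f -` B \<inter> space M \<in> sets M" by simp
  qed
  finally show "f -` U \<inter> space M \<in> sets M" .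
qed

lemma norm_le_iff_inner_dense:
  fixes x :: "'h::real_inner"
  assumes D: "closure D = UNIV" and r: "0 \<le> r"
  shows "norm x \<le> r \<longleftrightarrow> (\<forall>d\<in>D. inner x d \<le> r * norm d)"
proof
  assume "norm x \<le> r"
  then show "\<forall>d\<in>D. inner x d \<le> r * norm d"
    using norm_cauchy_schwarz mult_right_mono norm_ge_zero order_trans by metis
next
  assume "\<forall>d\<in>D. inner x d \<le> r * norm d"
  moreover have "closed {d. inner x d \<le> r * norm d}"
    by (intro closed_Collect_le continuous_intros)
  ultimately have "inner x x \<le> r * norm x"
    using closure_minimal[of D "{d. inner x d \<le> r * norm d}"] D by auto
  then show "norm x \<le> r"
    using r by (cases "x = 0") (simp_all add: power2_norm_eq_inner[symmetric] power2_eq_square)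
qed

lemma borel_measurable_norm_weakI:
  fixes f :: "'a \<Rightarrow> 'h::{real_inner,second_countable_topology}"
  assumes [measurable]: "\<And>z. (\<lambda>x. inner (f x) z) \<in> borel_measurable M"
  shows "(\<lambda>x. norm (f x)) \<in> borel_measurable M"
  unfolding borel_measurable_iff_le
proof
  fix r :: real
  obtain D :: "'h set" where D: "countable D" "closure D = UNIV"
    by (rule separable[of UNIV]) auto
  show "{x\<in>space M. norm (f x) \<le> r} \<in> sets M"
  proof (cases "0 \<le> r")
    case True
    have "{x\<in>space M. norm (f x) \<le> r} = {x\<in>space M. \<forall>d\<in>D. inner (f x) d \<le> r * norm d}"
      by (simp add: norm_le_iff_inner_dense[OF D(2) True])
    also have "\<dots> \<in> sets M" using D(1) by measurable
    finally show ?thesis .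
  next
    case False
    then have "{x\<in>space M. norm (f x) \<le> r} = {}" using norm_ge_zero order_trans by blast
    then show ?thesis by (metis sets.empty_sets)
  qed
qed

lemma borel_measurable_weakI:
  fixes f :: "'a \<Rightarrow> 'h::{real_inner,second_countable_topology}"
  assumes [measurable]: "\<And>z. (\<lambda>x. inner (f x) z) \<in> borel_measurable M"
  shows "f \<in> borel_measurable M"
proof (rule borel_measurable_distI)
  show "(\<lambda>x. dist c (f x)) \<in> borel_measurable M" for c
    unfolding dist_norm by (rule borel_measurable_norm_weakI) (simp add: inner_diff_left)
qed

text \<open>The sort \<open>{real_inner, complete_space}\<close> is not contained in the class \<open>banach\<close>, for which the
  library states the existence of Bochner integrals.\<close>
lemma integrableI_norm:
  fixes f :: "'a \<Rightarrow> 'b::{real_normed_vector,complete_space,second_countable_topology}"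
  assumes meas [measurable]: "f \<in> borel_measurable M" and int: "integrable M (\<lambda>x. norm (f x))"
  shows "integrable M f"
proof -
  obtain s where s: "\<And>i. simple_function M (s i)" "\<And>x. x \<in> space M \<Longrightarrow> (\<lambda>i. s i x) \<longlonglongrightarrow> f x"
    "\<And>i x. x \<in> space M \<Longrightarrow> norm (s i x) \<le> 2 * norm (f x)"
    using borel_measurable_implies_sequence_metric[OF meas, of 0] by (simp add: dist_norm) blast
  have [measurable]: "s i \<in> borel_measurable M" for i using s(1)
    by (rule borel_measurable_simple_function)
  have fin: "(\<integral>\<^sup>+x. ennreal (c * norm (f x)) \<partial>M) < \<infinity>" if "0 \<le> c" for c
    using int that by (subst nn_integral_eq_integral) auto
  have simple: "Bochner_Integration.simple_bochner_integrable M (s i)" for i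
  proof (rule simple_bochner_integrableI_bounded[OF s(1)])
    show "(\<integral>\<^sup>+x. norm (s i x) \<partial>M) < \<infinity>"
      using s(3) by (intro le_less_trans[OF nn_integral_mono fin[of 2]] ennreal_leI) auto
  qed
  define S where "S i = (\<integral>\<^sup>+x. norm (f x - s i x) \<partial>M)" for i
  have S_fin: "S i < \<infinity>" for i
  proof -
    have "norm (f x - s i x) \<le> 3 * norm (f x)" if "x \<in> space M" for x
      using norm_triangle_ineq4[of "f x" "s i x"] s(3)[OF that, of i] by simp
    then show ?thesis
      unfolding S_def by (intro le_less_trans[OF nn_integral_mono fin[of 3]] ennreal_leI) auto
  qed
  have S_lim: "S \<longlonglongrightarrow> 0"
    unfolding S_def
    by (rule nn_integral_dominated_convergence_norm[where w="\<lambda>x. 2 * norm (f x)"])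
       (use s fin[of 2] in auto)
  let ?I = "\<lambda>i. Bochner_Integration.simple_bochner_integral M (s i)"
  have "Cauchy ?I"
  proof (rule CauchyI_dist_le_add)
    show "(\<lambda>i. enn2real (S i)) \<longlonglongrightarrow> 0" using tendsto_enn2real[OF S_lim[folded ennreal_0]] by simp
    fix i j
    have "ennreal (dist (?I i) (?I j)) \<le> S i + S j"
      unfolding dist_norm S_def
      by (intro Bochner_Integration.simple_bochner_integral_bounded meas simple)
    also have "\<dots> = ennreal (enn2real (S i) + enn2real (S j))" using S_fin
      by (simp add: ennreal_plus)
    finally show "dist (?I i) (?I j) \<le> enn2real (S i) + enn2real (S j)"
      by (subst (asm) ennreal_le_iff) auto
  qed
  then obtain I where "?I \<longlonglongrightarrow> I" using Cauchy_convergent convergent_def by blast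
  then have "has_bochner_integral M f I"
    using S_lim
    by (intro has_bochner_integral.intros[OF meas simple]) (simp_all add: S_def[abs_def])
  then show ?thesis by (rule integrable.intros)
qed

lemma integrable_dominated:
  fixes f :: "'a \<Rightarrow> 'b::{real_normed_vector,complete_space,second_countable_topology}"
  assumes [measurable]: "f \<in> borel_measurable M"
    and "integrable M g" "\<And>x. x \<in> space M \<Longrightarrow> norm (f x) \<le> g x"
  shows "integrable M f"
proof (rule integrableI_norm)
  have "norm (norm (f x)) \<le> norm (g x)" if "x \<in> space M" for x
    using assms(3)[OF that] by simp
  then show "integrable M (\<lambda>x. norm (f x))"
    by (intro Bochner_Integration.integrable_bound[OF assms(2)] AE_I2) auto
qed fact

lemma norm_integral_le_dominated:
  fixes f :: "'a \<Rightarrow> 'b::{real_normed_vector,second_countable_topology}"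
  assumes f: "integrable M f" and g: "integrable M g" "\<And>x. x \<in> space M \<Longrightarrow> norm (f x) \<le> g x"
  shows "norm (LINT x|M. f x) \<le> (LINT x|M. g x)"
proof -
  have nonneg: "0 \<le> g x" if "x \<in> space M" for x using g(2)[OF that] norm_ge_zero order_trans
    by blast
  have "ennreal (norm (LINT x|M. f x)) \<le> (\<integral>\<^sup>+x. norm (f x) \<partial>M)"
    by (rule integral_norm_bound_ennreal[OF f])
  also have "\<dots> \<le> (\<integral>\<^sup>+x. ennreal (g x) \<partial>M)" using g(2) by (intro nn_integral_mono ennreal_leI)
  also have "\<dots> = ennreal (LINT x|M. g x)" using nonneg by (intro nn_integral_eq_integral g(1)) auto
  finally show ?thesis using nonneg by (simp add: integral_nonneg)
qed

lemma integrable_norm_real_normed_vector: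
  fixes f :: "'a \<Rightarrow> 'b::{real_normed_vector,second_countable_topology}"
  assumes f: "integrable M f"
  shows "integrable M (\<lambda>x. norm (f x))"
  using has_bochner_integral_implies_finite_norm[OF has_bochner_integral_integrable[OF f]] f
  by (intro integrableI_bounded) auto

lemma integral_restrict_space_complete:
  fixes f :: "'a \<Rightarrow> 'h::{real_inner,complete_space,second_countable_topology}"
  assumes \<Omega>: "\<Omega> \<in> sets M" and f: "integrable (restrict_space M \<Omega>) f"
  shows "(LINT x|restrict_space M \<Omega>. f x) = (LINT x:\<Omega>|M. f x)"
proof -
  have \<Omega>': "\<Omega> \<inter> space M \<in> sets M" using \<Omega> by simp
  have "integrable M (\<lambda>x. indicator \<Omega> x *\<^sub>R f x)"
  proof (rule integrableI_norm)
    show "(\<lambda>x. indicator \<Omega> x *\<^sub>R f x) \<in> borel_measurable M"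
      using f by (simp flip: borel_measurable_restrict_space_iff[OF \<Omega>'])
    have "integrable M (\<lambda>x. indicator \<Omega> x *\<^sub>R norm (f x))"
      using integrable_norm_real_normed_vector[OF f]
      by (subst integrable_restrict_space[OF \<Omega>', symmetric])
    then show "integrable M (\<lambda>x. norm (indicator \<Omega> x *\<^sub>R f x))" by simp
  qed
  then have "inner (LINT x|restrict_space M \<Omega>. f x) y = inner (LINT x:\<Omega>|M. f x) y" for y
    using f integral_restrict_space[OF \<Omega>', of "\<lambda>x. inner (f x) y"]
    by (simp add: set_lebesgue_integral_def flip: integral_inner_left)
  then show ?thesis using vector_eq_rdot by blast
qed

section \<open>Convergence in probability\<close>

text \<open>Both notions use one tolerance for the distance and for the probability; since the probability
  decreases in the tolerance, this amounts to the usual definition with two.\<close>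
definition tendsto_in_prob :: "'a measure \<Rightarrow> (nat \<Rightarrow> 'a \<Rightarrow> 'b::metric_space) \<Rightarrow> ('a \<Rightarrow> 'b) \<Rightarrow> bool" where
  "tendsto_in_prob M X Y \<longleftrightarrow>
    (\<forall>e>0. \<exists>N. \<forall>k\<ge>N. measure M {\<omega>\<in>space M. e < dist (X k \<omega>) (Y \<omega>)} < e)"

definition Cauchy_in_prob :: "'a measure \<Rightarrow> (nat \<Rightarrow> 'a \<Rightarrow> 'b::metric_space) \<Rightarrow> bool" where
  "Cauchy_in_prob M X \<longleftrightarrow>
    (\<forall>e>0. \<exists>N. \<forall>k\<ge>N. \<forall>l\<ge>N. measure M {\<omega>\<in>space M. e < dist (X k \<omega>) (X l \<omega>)} < e)"

lemma strict_mono_choice: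
  fixes Q :: "nat \<Rightarrow> nat \<Rightarrow> bool"
  assumes "\<And>j. \<exists>N. \<forall>k\<ge>N. Q j k"
  obtains r where "strict_mono r" "\<And>j. Q j (r j)"
proof -
  obtain N where N: "\<And>j k. N j \<le> k \<Longrightarrow> Q j k" using assms by metis
  define r where "r j = j + (\<Sum>i\<le>j. N i)" for j
  have "strict_mono r" by (auto simp: strict_mono_Suc_iff r_def)
  moreover have "Q j (r j)" for j
    unfolding r_def by (intro N trans_le_add2 member_le_sum) auto
  ultimately show thesis by (rule that)
qed

lemma Cauchy_in_prob_subseq:
  assumes "Cauchy_in_prob M X" and r: "strict_mono r"
  shows "Cauchy_in_prob M (\<lambda>k. X (r k))"
  unfolding Cauchy_in_prob_def
proof (intro allI impI)
  fix e :: real assume "0 < e"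
  then obtain N where "\<And>k l. k \<ge> N \<Longrightarrow> l \<ge> N \<Longrightarrow> measure M {\<omega>\<in>space M. e < dist (X k \<omega>) (X l \<omega>)} < e"
    using assms(1) unfolding Cauchy_in_prob_def by meson
  then show "\<exists>N. \<forall>k\<ge>N. \<forall>l\<ge>N. measure M {\<omega>\<in>space M. e < dist (X (r k) \<omega>) (X (r l) \<omega>)} < e"
    using strict_mono_imp_increasing[OF r] order_trans by (intro exI[of _ N]) blast
qed

lemma convergent_of_dist_Suc_le_geometric:
  fixes x :: "nat \<Rightarrow> 'b::complete_space"
  assumes "\<forall>\<^sub>F k in sequentially. dist (x k) (x (Suc k)) \<le> (1/2)^k"
  shows "convergent x"
proof -
  obtain K where K: "\<And>k. k \<ge> K \<Longrightarrow> dist (x k) (x (Suc k)) \<le> (1/2)^k"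
    using assms by (auto simp: eventually_sequentially)
  define e :: "nat \<Rightarrow> real" where "e k = 2 * (1/2)^(k + K)" for k
  have tail: "dist (x (i + K)) (x (i + K + m)) \<le> e i - e (i + m)" for i m
  proof (induction m)
    case (Suc m)
    have "dist (x (i + K)) (x (i + K + Suc m)) \<le> e i - e (i + m) + (1/2)^(i + K + m)"
      using dist_triangle[of "x (i + K)" "x (i + K + Suc m)" "x (i + K + m)"] Suc K[of "i + K + m"]
      by simp
    also have "\<dots> = e i - e (i + Suc m)" by (simp add: e_def power_add)
    finally show ?case .
  qed simp
  have tail_le: "dist (x (i + K)) (x (j + K)) \<le> e i + e j" if "i \<le> j" for i j
  proof -
    have "i + K + (j - i) = j + K" "i + (j - i) = j" "0 \<le> e j" using that by (simp_all add: e_def)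
    with tail[of i "j - i"] show ?thesis by simp
  qed
  have "Cauchy (\<lambda>i. x (i + K))"
  proof (rule CauchyI_dist_le_add)
    show "dist (x (i + K)) (x (j + K)) \<le> e i + e j" for i j
      using tail_le[of i j] tail_le[of j i]
      by (cases "i \<le> j") (simp_all add: dist_commute add.commute)
    have "e \<longlonglongrightarrow> 2 * 0"
      unfolding e_def by (intro tendsto_intros LIMSEQ_ignore_initial_segment LIMSEQ_power_zero) simp
    then show "e \<longlonglongrightarrow> 0" by simp
  qed
  then show ?thesis using Cauchy_convergent convergent_ignore_initial_segment by blast
qed

lemma measurable_AE_limit:
  fixes X :: "nat \<Rightarrow> 'a \<Rightarrow> 'b::{complete_space,second_countable_topology}"
  assumes [measurable]: "\<And>k. X k \<in> borel_measurable M"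
    and conv: "AE \<omega> in M. convergent (\<lambda>k. X k \<omega>)"
  obtains V where "V \<in> borel_measurable M" "AE \<omega> in M. (\<lambda>k. X k \<omega>) \<longlonglongrightarrow> V \<omega>"
proof
  define X' where "X' k \<omega> = (if Cauchy (\<lambda>k. X k \<omega>) then X k \<omega> else undefined)" for k \<omega>
  have "convergent (\<lambda>k. X' k \<omega>)" for \<omega>
    by (cases "Cauchy (\<lambda>k. X k \<omega>)") (simp_all add: X'_def Cauchy_convergent convergent_const)
  then have X'_lim: "(\<lambda>k. X' k \<omega>) \<longlonglongrightarrow> lim (\<lambda>k. X' k \<omega>)" for \<omega>
    by (simp add: convergent_LIMSEQ_iff)
  have [measurable]: "X' k \<in> borel_measurable M" for k unfolding X'_def by measurable
  show "(\<lambda>\<omega>. lim (\<lambda>k. X' k \<omega>)) \<in> borel_measurable M"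
    by (rule borel_measurable_LIMSEQ_metric[OF _ X'_lim]) measurable
  show "AE \<omega> in M. (\<lambda>k. X k \<omega>) \<longlonglongrightarrow> lim (\<lambda>k. X' k \<omega>)"
    using conv
  proof eventually_elim
    case (elim \<omega>)
    then have "X' k \<omega> = X k \<omega>" for k by (simp add: X'_def convergent_Cauchy)
    then show ?case using X'_lim[of \<omega>] by simp
  qed
qed

context prob_space
begin

lemma AE_eventually_le_geometric:
  fixes f :: "nat \<Rightarrow> 'a \<Rightarrow> real"
  assumes [measurable]: "\<And>k. f k \<in> borel_measurable M"
    and small: "\<And>k. prob {\<omega>\<in>space M. (1/2)^k < f k \<omega>} < (1/2)^k"
  shows "AE \<omega> in M. \<forall>\<^sub>F k in sequentially. f k \<omega> \<le> (1/2)^k"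
proof -
  let ?A = "\<lambda>k. {\<omega>\<in>space M. (1/2)^k < f k \<omega>}"
  have "summable (\<lambda>k. prob (?A k))"
    using small less_imp_le
    by (intro summable_comparison_test'[OF summable_geometric[of "1/2::real"], where N=0]) auto
  then have "AE \<omega> in M. eventually (\<lambda>k. \<omega> \<in> space M - ?A k) sequentially"
    by (intro borel_cantelli_AE1) (auto simp: emeasure_eq_measure)
  then show ?thesis by eventually_elim (auto elim: eventually_mono)
qed

lemma tendsto_in_prob_AE_subseq:
  fixes X :: "nat \<Rightarrow> 'a \<Rightarrow> 'b::{metric_space,second_countable_topology}"
  assumes [measurable]: "\<And>k. X k \<in> borel_measurable M" "Y \<in> borel_measurable M"
    and lim: "tendsto_in_prob M X Y"
  obtains r where "strict_mono r" "AE \<omega> in M. (\<lambda>j. X (r j) \<omega>) \<longlonglongrightarrow> Y \<omega>"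
proof -
  let ?small = "\<lambda>j k. prob {\<omega>\<in>space M. (1/2)^j < dist (X k \<omega>) (Y \<omega>)} < (1/2)^j"
  have "\<exists>N. \<forall>k\<ge>N. ?small j k" for j
    using lim by (simp add: tendsto_in_prob_def)
  then obtain r where r: "strict_mono r" and small: "\<And>j. ?small j (r j)"
    using strict_mono_choice[of ?small] by blast
  have "AE \<omega> in M. \<forall>\<^sub>F j in sequentially. dist (X (r j) \<omega>) (Y \<omega>) \<le> (1/2)^j"
    using small by (intro AE_eventually_le_geometric) auto
  then have "AE \<omega> in M. (\<lambda>j. X (r j) \<omega>) \<longlonglongrightarrow> Y \<omega>"
  proof eventually_elim
    case (elim \<omega>)
    then have "(\<lambda>j. dist (X (r j) \<omega>) (Y \<omega>)) \<longlonglongrightarrow> 0"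
      by (intro tendsto_sandwich[OF _ _ tendsto_const LIMSEQ_power_zero[of "1/2::real"]]) auto
    then show ?case by (rule iffD2[OF tendsto_dist_iff])
  qed
  with r show thesis by (rule that)
qed

lemma Cauchy_in_prob_AE_subseq:
  fixes X :: "nat \<Rightarrow> 'a \<Rightarrow> 'b::{complete_space,second_countable_topology}"
  assumes [measurable]: "\<And>k. X k \<in> borel_measurable M" and "Cauchy_in_prob M X"
  obtains r V where "strict_mono r" "V \<in> borel_measurable M" "AE \<omega> in M. (\<lambda>j. X (r j) \<omega>) \<longlonglongrightarrow> V \<omega>"
proof -
  let ?small = "\<lambda>j k. \<forall>l\<ge>k. prob {\<omega>\<in>space M. (1/2)^j < dist (X k \<omega>) (X l \<omega>)} < (1/2)^j"
  have "\<exists>N. \<forall>k\<ge>N. ?small j k" for j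
    using assms(2) unfolding Cauchy_in_prob_def
    by (meson half_gt_zero order_trans zero_less_one zero_less_power)
  then obtain r where r: "strict_mono r" and small: "\<And>j. ?small j (r j)"
    using strict_mono_choice[of ?small] by blast
  have "r j \<le> r (Suc j)" for j using r by (simp add: strict_mono_less_eq)
  then have "AE \<omega> in M. \<forall>\<^sub>F j in sequentially. dist (X (r j) \<omega>) (X (r (Suc j)) \<omega>) \<le> (1/2)^j"
    using small by (intro AE_eventually_le_geometric) auto
  then have "AE \<omega> in M. convergent (\<lambda>j. X (r j) \<omega>)"
    by eventually_elim (rule convergent_of_dist_Suc_le_geometric)
  then obtain V where "V \<in> borel_measurable M" "AE \<omega> in M. (\<lambda>j. X (r j) \<omega>) \<longlonglongrightarrow> V \<omega>"
    by (rule measurable_AE_limit[rotated]) auto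
  with r show thesis by (rule that)
qed

lemma tendsto_in_prob_imp_Cauchy:
  fixes X :: "nat \<Rightarrow> 'a \<Rightarrow> 'b::{metric_space,second_countable_topology}"
  assumes [measurable]: "\<And>k. X k \<in> borel_measurable M" "Y \<in> borel_measurable M"
    and lim: "tendsto_in_prob M X Y"
  shows "Cauchy_in_prob M X"
  unfolding Cauchy_in_prob_def
proof (intro allI impI)
  fix e :: real assume e: "0 < e"
  let ?D = "\<lambda>k. {\<omega>\<in>space M. e / 2 < dist (X k \<omega>) (Y \<omega>)}"
  obtain N where N: "\<And>k. k \<ge> N \<Longrightarrow> prob (?D k) < e / 2"
    using lim e unfolding tendsto_in_prob_def by (meson half_gt_zero)
  have "prob {\<omega>\<in>space M. e < dist (X k \<omega>) (X l \<omega>)} < e" if "k \<ge> N" "l \<ge> N" for k l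
  proof -
    have "{\<omega>\<in>space M. e < dist (X k \<omega>) (X l \<omega>)} \<subseteq> ?D k \<union> ?D l"
    proof safe
      fix \<omega> assume "e < dist (X k \<omega>) (X l \<omega>)" "\<not> e / 2 < dist (X l \<omega>) (Y \<omega>)"
      then show "e / 2 < dist (X k \<omega>) (Y \<omega>)"
        using dist_triangle2[of "X k \<omega>" "X l \<omega>" "Y \<omega>"] by linarith
    qed
    then have "prob {\<omega>\<in>space M. e < dist (X k \<omega>) (X l \<omega>)} \<le> prob (?D k \<union> ?D l)"
      by (rule finite_measure_mono) measurable
    also have "\<dots> \<le> prob (?D k) + prob (?D l)" by (rule measure_Un_le) measurable
    also have "\<dots> < e" using N[OF that(1)] N[OF that(2)] by simp
    finally show ?thesis .
  qed
  then show "\<exists>N. \<forall>k\<ge>N. \<forall>l\<ge>N. prob {\<omega>\<in>space M. e < dist (X k \<omega>) (X l \<omega>)} < e" by blast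
qed

end

section \<open>Laws determined by bounded continuous functions\<close>

lemma closed_indicator_limit:
  fixes F :: "'a::metric_space set"
  assumes F: "closed F" "F \<noteq> {}"
  shows "(\<lambda>k. max 0 (1 - real k * infdist x F)) \<longlonglongrightarrow> indicator F x"
proof (cases "x \<in> F")
  case False
  then have pos: "0 < infdist x F"
    using F infdist_nonneg[of x F] by (simp add: in_closed_iff_infdist_zero order_less_le)
  have "eventually (\<lambda>k. 1 / infdist x F < real k) sequentially"
    using filterlim_real_sequentially by (simp add: filterlim_at_top_dense)
  then have "eventually (\<lambda>k. max 0 (1 - real k * infdist x F) = 0) sequentially"
    by eventually_elim (use pos in \<open>simp add: field_simps\<close>)
  then show ?thesis using False by (simp add: tendsto_eventually)
qed simp

lemma measure_eqI_bounded_continuous: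
  fixes \<mu> \<nu> :: "'a::metric_space measure"
  assumes "finite_measure \<mu>" "finite_measure \<nu>"
    and sets: "sets \<mu> = sets borel" "sets \<nu> = sets borel"
    and eq: "\<And>f :: 'a \<Rightarrow> real. continuous_on UNIV f \<Longrightarrow> (\<And>x. 0 \<le> f x \<and> f x \<le> 1) \<Longrightarrow>
      (LINT x|\<mu>. f x) = (LINT x|\<nu>. f x)"
  shows "\<mu> = \<nu>"
proof (rule measure_eqI_generator_eq[where E="Collect closed" and \<Omega>=UNIV and A="\<lambda>_. UNIV"])
  interpret \<mu>: finite_measure \<mu> by fact
  interpret \<nu>: finite_measure \<nu> by fact
  note [measurable_cong] = sets
  show "Int_stable (Collect closed)" by (auto simp: Int_stable_def)
  show "sets \<mu> = sigma_sets UNIV (Collect closed)" "sets \<nu> = sigma_sets UNIV (Collect closed)"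
    using sets by (auto simp: borel_eq_closed)
  show "emeasure \<mu> UNIV \<noteq> \<infinity>" by simp
  fix F :: "'a set" assume "F \<in> Collect closed"
  then have F: "closed F" by simp
  show "emeasure \<mu> F = emeasure \<nu> F"
  proof (cases "F = {}")
    case False
    define f where "f k x = max 0 (1 - real k * infdist x F)" for k x
    have cont: "continuous_on UNIV (f k)" for k
      unfolding f_def by (intro continuous_intros)
    then have [measurable]: "f k \<in> borel_measurable borel" for k
      by (rule borel_measurable_continuous_onI)
    have bound: "0 \<le> f k x \<and> f k x \<le> 1" for k x by (auto simp: f_def infdist_nonneg)
    have lim: "(\<lambda>k. LINT x|\<rho>. f k x) \<longlonglongrightarrow> (LINT x|\<rho>. indicator F x)"
      if "finite_measure \<rho>" and [measurable_cong]: "sets \<rho> = sets borel" for \<rho>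
    proof (rule integral_dominated_convergence[where w="\<lambda>_. 1"])
      interpret \<rho>: finite_measure \<rho> by fact
      show "integrable \<rho> (\<lambda>_. 1::real)" by simp
      show "AE x in \<rho>. (\<lambda>k. f k x) \<longlonglongrightarrow> indicator F x"
        unfolding f_def using closed_indicator_limit[OF F False] by simp
      have "F \<in> sets borel" using F by simp
      then show "indicat_real F \<in> borel_measurable \<rho>" by measurable
    qed (use bound in auto)
    have "(LINT x|\<mu>. indicator F x) = (LINT x|\<nu>. indicator F x :: real)"
      using lim[of \<mu>] lim[of \<nu>] eq[OF cont bound] sets
        \<mu>.finite_measure_axioms \<nu>.finite_measure_axioms
      by (simp add: LIMSEQ_unique)
    then show ?thesis
      using F by (simp add: \<mu>.emeasure_eq_measure \<nu>.emeasure_eq_measure sets sets_eq_imp_space_eq)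
  qed simp
qed auto

lemma distr_eq_of_AE_limits:
  fixes X :: "'a \<Rightarrow> 'c::{metric_space,second_countable_topology}" and X' :: "'b \<Rightarrow> 'c"
  assumes M: "prob_space M" "prob_space M'"
    and [measurable]: "\<And>k. Xs k \<in> borel_measurable M" "X \<in> borel_measurable M"
      "\<And>k. Xs' k \<in> borel_measurable M'" "X' \<in> borel_measurable M'"
    and lim: "AE x in M. (\<lambda>k. Xs k x) \<longlonglongrightarrow> X x" "AE x in M'. (\<lambda>k. Xs' k x) \<longlonglongrightarrow> X' x"
    and eq: "\<And>k. distr M borel (Xs k) = distr M' borel (Xs' k)"
  shows "distr M borel X = distr M' borel X'"
proof (rule measure_eqI_bounded_continuous)
  interpret M: prob_space M by fact
  interpret M': prob_space M' by fact
  show "finite_measure (distr M borel X)" "finite_measure (distr M' borel X')"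
    by (auto intro: M.finite_measure_distr M'.finite_measure_distr)
  fix f :: "'c \<Rightarrow> real" assume f: "continuous_on UNIV f" "\<And>x. 0 \<le> f x \<and> f x \<le> 1"
  have [measurable]: "f \<in> borel_measurable borel"
    using f(1) by (rule borel_measurable_continuous_onI)
  have f_lim: "(\<lambda>k. f (u k)) \<longlonglongrightarrow> f v" if "u \<longlonglongrightarrow> v" for u v
    using continuous_on_tendsto_compose[OF f(1) that] by simp
  have "(\<lambda>k. LINT x|M. f (Xs k x)) \<longlonglongrightarrow> (LINT x|M. f (X x))"
    by (rule integral_dominated_convergence[where w="\<lambda>_. 1"])
       (use f lim(1) in \<open>auto intro: f_lim\<close>)
  moreover have "(\<lambda>k. LINT x|M'. f (Xs' k x)) \<longlonglongrightarrow> (LINT x|M'. f (X' x))"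
    by (rule integral_dominated_convergence[where w="\<lambda>_. 1"])
       (use f lim(2) in \<open>auto intro: f_lim\<close>)
  moreover have "(LINT x|M. f (Xs k x)) = (LINT x|M'. f (Xs' k x))" for k
    using arg_cong[OF eq[of k], of "\<lambda>D. LINT x|D. f x"] by (simp add: integral_distr)
  ultimately show "(LINT x|distr M borel X. f x) = (LINT x|distr M' borel X'. f x)"
    by (simp add: integral_distr LIMSEQ_unique)
qed simp_all

section \<open>Sums of independent variables and convolution powers\<close>

context prob_space
begin

lemma indep_vars_block_sums:
  fixes X :: "'i \<Rightarrow> 'a \<Rightarrow> 'h::{real_normed_vector,second_countable_topology}"
  assumes "indep_vars (\<lambda>_. borel) X I" "\<And>j. j \<in> J \<Longrightarrow> K j \<subseteq> I" "disjoint_family_on K J"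
  shows "indep_vars (\<lambda>_. borel) (\<lambda>j \<omega>. \<Sum>i\<in>K j. X i \<omega>) J"
proof -
  have "indep_vars (\<lambda>_. borel) (\<lambda>j \<omega>. (\<lambda>f. \<Sum>i\<in>K j. f i) (\<lambda>i\<in>K j. X i \<omega>)) J"
    by (rule indep_vars_compose2[OF indep_vars_restrict[OF assms]]) measurable
  then show ?thesis by simp
qed

lemma indep_vars_inj:
  assumes "indep_vars N X I" "f ` J \<subseteq> I" "inj_on f J"
  shows "indep_vars (\<lambda>j. N (f j)) (\<lambda>j. X (f j)) J"
proof -
  have "indep_vars (\<lambda>j. PiM {f j} N) (\<lambda>j \<omega>. \<lambda>i\<in>{f j}. X i \<omega>) J"
    using assms by (intro indep_vars_restrict) (auto simp: disjoint_family_on_def inj_on_def)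
  then have "indep_vars (\<lambda>j. N (f j)) (\<lambda>j \<omega>. (\<lambda>i\<in>{f j}. X i \<omega>) (f j)) J"
    by (rule indep_vars_compose2) (simp add: measurable_component_singleton)
  then show ?thesis by simp
qed

lemma indep_vars_const:
  assumes "finite I" and meas: "\<And>i. i \<in> I \<Longrightarrow> {c i} \<in> sets (N i)"
  shows "indep_vars N (\<lambda>i _. c i) I"
proof (cases "I = {}")
  case False
  have c: "c i \<in> space (N i)" if "i \<in> I" for i
    using sets.sets_into_space[OF meas[OF that]] by simp
  have "distr M (PiM I N) (\<lambda>_. \<lambda>i\<in>I. c i) = return (PiM I N) (restrict c I)"
    using c by (intro distr_const) (simp add: space_PiM)
  also have "\<dots> = PiM I (\<lambda>i. return (N i) (c i))" using assms by (intro PiM_return[symmetric])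
  also have "\<dots> = PiM I (\<lambda>i. distr M (N i) (\<lambda>_. c i))"
    using c by (intro PiM_cong refl) simp
  finally show ?thesis using False c by (subst indep_vars_iff_distr_eq_PiM') auto
qed (simp add: indep_vars_def2 indep_sets_def)

lemma distr_add_indep:
  fixes X Y :: "'a \<Rightarrow> 'h::{real_normed_vector,second_countable_topology}"
  assumes "indep_var borel X borel Y"
  shows "distr M borel (\<lambda>\<omega>. X \<omega> + Y \<omega>) = mconv (distr M borel X) (distr M borel Y)"
proof -
  have [measurable]: "X \<in> borel_measurable M" "Y \<in> borel_measurable M"
    using assms by (auto dest: indep_var_rv1 indep_var_rv2)
  have "mconv (distr M borel X) (distr M borel Y) =
      distr (distr M (borel \<Otimes>\<^sub>M borel) (\<lambda>\<omega>. (X \<omega>, Y \<omega>))) borel (\<lambda>(x, y). x + y)"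
    using assms by (simp add: mconv_def indep_var_distribution_eq)
  also have "\<dots> = distr M borel (\<lambda>\<omega>. X \<omega> + Y \<omega>)" by (subst distr_distr) (auto simp: comp_def)
  finally show ?thesis ..
qed

lemma distr_sum_indep_identical:
  fixes X :: "'i \<Rightarrow> 'a \<Rightarrow> 'h::{real_normed_vector,second_countable_topology}"
  assumes "finite I" "indep_vars (\<lambda>_. borel) X I" "\<And>i. i \<in> I \<Longrightarrow> distr M borel (X i) = \<mu>"
  shows "distr M borel (\<lambda>\<omega>. \<Sum>i\<in>I. X i \<omega>) = mconv_pow \<mu> (card I)"
  using assms
proof (induction I rule: finite_induct)
  case empty
  show ?case by simp
next
  case (insert i F)
  have "indep_var borel ((\<lambda>f. f i) \<circ> (\<lambda>\<omega>. \<lambda>i\<in>{i}. X i \<omega>))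
      borel ((\<lambda>f. \<Sum>i\<in>F. f i) \<circ> (\<lambda>\<omega>. \<lambda>i\<in>F. X i \<omega>))"
    by (rule indep_var_compose[OF indep_var_restrict[OF insert.prems(1)]]) (use insert.hyps in auto)
  then have "indep_var borel (X i) borel (\<lambda>\<omega>. \<Sum>i\<in>F. X i \<omega>)" by (simp add: comp_def)
  moreover have "distr M borel (\<lambda>\<omega>. \<Sum>i\<in>F. X i \<omega>) = mconv_pow \<mu> (card F)"
    using insert.prems by (intro insert.IH indep_vars_subset[OF insert.prems(1)]) auto
  ultimately show ?case using insert by (simp add: distr_add_indep)
qed

lemma distr_sum_indep_cong:
  fixes X Y :: "'i \<Rightarrow> 'a \<Rightarrow> 'b::topological_space"
    and T :: "'i \<Rightarrow> 'b \<Rightarrow> 'h::{real_normed_vector,second_countable_topology}"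
  assumes X: "indep_vars (\<lambda>_. borel) X I" and Y: "indep_vars (\<lambda>_. borel) Y I"
    and eq: "\<And>i. i \<in> I \<Longrightarrow> distr M borel (X i) = distr M borel (Y i)"
    and [measurable]: "\<And>i. i \<in> I \<Longrightarrow> T i \<in> borel_measurable borel"
  shows "distr M borel (\<lambda>\<omega>. \<Sum>i\<in>I. T i (X i \<omega>)) = distr M borel (\<lambda>\<omega>. \<Sum>i\<in>I. T i (Y i \<omega>))"
proof (cases "I = {}")
  case False
  have law: "distr M borel (\<lambda>\<omega>. \<Sum>i\<in>I. T i (X i \<omega>)) =
      distr (\<Pi>\<^sub>M i\<in>I. distr M borel (X i)) borel (\<lambda>f. \<Sum>i\<in>I. T i (f i))"
    if X: "indep_vars (\<lambda>_. borel) X I" for X :: "'i \<Rightarrow> 'a \<Rightarrow> 'b"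
  proof -
    have [measurable]: "X i \<in> borel_measurable M" if "i \<in> I" for i
      using X that by (auto simp: indep_vars_def)
    have "distr M borel (\<lambda>\<omega>. \<Sum>i\<in>I. T i (X i \<omega>)) =
        distr (distr M (\<Pi>\<^sub>M i\<in>I. borel) (\<lambda>x. \<lambda>i\<in>I. X i x)) borel (\<lambda>f. \<Sum>i\<in>I. T i (f i))"
      by (subst distr_distr) (auto simp: comp_def)
    also have "distr M (\<Pi>\<^sub>M i\<in>I. borel) (\<lambda>x. \<lambda>i\<in>I. X i x) = (\<Pi>\<^sub>M i\<in>I. distr M borel (X i))"
      using X False by (subst indep_vars_iff_distr_eq_PiM'[symmetric]) auto
    finally show ?thesis .
  qed
  have "(\<Pi>\<^sub>M i\<in>I. distr M borel (X i)) = (\<Pi>\<^sub>M i\<in>I. distr M borel (Y i))"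
    by (intro PiM_cong eq refl)
  then show ?thesis by (simp add: law[OF X] law[OF Y])
qed simp

text \<open>The sum over the whole grid is split into its columns, which are independent and have one
  common law.\<close>
lemma distr_linear_grid_sum:
  fixes X :: "'i \<times> 'j \<Rightarrow> 'a \<Rightarrow> 'g::{real_normed_vector,second_countable_topology}"
    and T :: "'i \<Rightarrow> 'g \<Rightarrow> 'h::{real_normed_vector,second_countable_topology}"
  assumes indep: "indep_vars (\<lambda>_. borel) X (I \<times> J)" and "finite J"
    and T: "\<And>i. i \<in> I \<Longrightarrow> bounded_linear (T i)"
    and Y: "indep_vars (\<lambda>_. borel) Y I"
    and law: "\<And>i j. i \<in> I \<Longrightarrow> j \<in> J \<Longrightarrow> distr M borel (X (i, j)) = distr M borel (Y i)"
  shows "distr M borel (\<lambda>\<omega>. \<Sum>i\<in>I. T i (\<Sum>j\<in>J. X (i, j) \<omega>)) =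
    mconv_pow (distr M borel (\<lambda>\<omega>. \<Sum>i\<in>I. T i (Y i \<omega>))) (card J)"
proof -
  have T_meas: "T i \<in> borel_measurable borel" if "i \<in> I" for i
    using linear_continuous_on[OF T[OF that]] by (rule borel_measurable_continuous_onI)
  let ?U = "\<lambda>j \<omega>. \<Sum>i\<in>I. T i (X (i, j) \<omega>)"
  have "indep_vars (\<lambda>_. borel) (\<lambda>p \<omega>. T (fst p) (X p \<omega>)) (I \<times> J)"
    using T_meas by (intro indep_vars_compose2[OF indep]) auto
  then have "indep_vars (\<lambda>_. borel) (\<lambda>j \<omega>. \<Sum>p\<in>(\<lambda>i. (i, j)) ` I. T (fst p) (X p \<omega>)) J"
    by (rule indep_vars_block_sums) (auto simp: disjoint_family_on_def)
  then have "indep_vars (\<lambda>_. borel) ?U J" by (simp add: sum.reindex inj_on_def)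
  moreover have "distr M borel (?U j) = distr M borel (\<lambda>\<omega>. \<Sum>i\<in>I. T i (Y i \<omega>))" if j: "j \<in> J" for j
  proof (rule distr_sum_indep_cong[OF _ Y])
    show "indep_vars (\<lambda>_. borel) (\<lambda>i. X (i, j)) I"
      by (rule indep_vars_inj[OF indep]) (use j in \<open>auto simp: inj_on_def\<close>)
  qed (use law j T_meas in auto)
  ultimately have "distr M borel (\<lambda>\<omega>. \<Sum>j\<in>J. ?U j \<omega>) =
      mconv_pow (distr M borel (\<lambda>\<omega>. \<Sum>i\<in>I. T i (Y i \<omega>))) (card J)"
    using distr_sum_indep_identical \<open>finite J\<close> by blast
  moreover have "(\<Sum>j\<in>J. ?U j \<omega>) = (\<Sum>i\<in>I. T i (\<Sum>j\<in>J. X (i, j) \<omega>))" for \<omega>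
    by (subst sum.swap) (auto intro!: sum.cong linear_sum[symmetric] bounded_linear.linear[OF T])
  ultimately show ?thesis by simp
qed

lemma distr_sum_PiM:
  fixes V :: "'a \<Rightarrow> 'h::{real_normed_vector,second_countable_topology}"
  assumes [measurable]: "V \<in> borel_measurable M" and J: "finite J" "J \<subseteq> I" "I \<noteq> {}"
  shows "distr (PiM I (\<lambda>_. M)) borel (\<lambda>\<omega>. \<Sum>j\<in>J. V (\<omega> j)) = mconv_pow (distr M borel V) (card J)"
proof -
  interpret Pi: product_prob_space "\<lambda>_. M" I ..
  have coord: "distr (PiM I (\<lambda>_. M)) M (\<lambda>\<omega>. \<omega> i) = M" if "i \<in> I" for i
    using that by (intro distr_PiM_component prob_space_axioms)
  have "distr (PiM I (\<lambda>_. M)) (PiM I (\<lambda>_. M)) (\<lambda>\<omega>. \<lambda>i\<in>I. \<omega> i) = PiM I (\<lambda>_. M)"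
    by (subst distr_cong[where g="\<lambda>\<omega>. \<omega>"]) (auto simp: space_PiM PiE_restrict)
  also have "\<dots> = (\<Pi>\<^sub>M i\<in>I. distr (PiM I (\<lambda>_. M)) M (\<lambda>\<omega>. \<omega> i))"
    by (intro PiM_cong refl) (simp add: coord)
  finally have "Pi.indep_vars (\<lambda>_. M) (\<lambda>i \<omega>. \<omega> i) I"
    using J(3) by (subst Pi.indep_vars_iff_distr_eq_PiM') auto
  then have "Pi.indep_vars (\<lambda>_. borel) (\<lambda>i \<omega>. V (\<omega> i)) I"
    by (rule Pi.indep_vars_compose2) measurable
  then have "Pi.indep_vars (\<lambda>_. borel) (\<lambda>i \<omega>. V (\<omega> i)) J"
    using J(2) by (rule Pi.indep_vars_subset)
  moreover have "distr (PiM I (\<lambda>_. M)) borel (\<lambda>\<omega>. V (\<omega> i)) = distr M borel V" if "i \<in> J" for i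
  proof -
    have i: "i \<in> I" using that J by blast
    have "distr (distr (PiM I (\<lambda>_. M)) M (\<lambda>\<omega>. \<omega> i)) borel V =
        distr (PiM I (\<lambda>_. M)) borel (\<lambda>\<omega>. V (\<omega> i))"
      using i by (subst distr_distr) (auto simp: comp_def)
    then show ?thesis using coord[OF i] by simp
  qed
  ultimately show ?thesis by (intro Pi.distr_sum_indep_identical J)
qed

end

section \<open>Convolution roots of limits in probability\<close>

lemma norm_le_of_leave_one_out_sums:
  fixes x :: "'i \<Rightarrow> 'h::real_normed_vector"
  assumes J: "finite J" "2 \<le> card J" and small: "\<And>j. j \<in> J \<Longrightarrow> norm (\<Sum>i\<in>J - {j}. x i) \<le> e"
    and j: "j \<in> J"
  shows "norm (x j) \<le> 3 * e"
proof -
  define s where "s = (\<Sum>i\<in>J. x i)"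
  have out: "(\<Sum>i\<in>J - {i}. x i) = s - x i" if "i \<in> J" for i
    using that J(1) by (simp add: s_def sum_diff1)
  have e: "0 \<le> e" using small[OF j] norm_ge_zero order_trans by blast
  have n: "1 \<le> real (card J) - 1" using J(2) by simp
  have "(real (card J) - 1) *\<^sub>R s = (\<Sum>i\<in>J. s - x i)"
    by (simp add: sum_subtractf sum_constant_scaleR scaleR_diff_left s_def)
  then have "(real (card J) - 1) * norm s = norm (\<Sum>i\<in>J. s - x i)"
    using n by (metis abs_of_nonneg norm_scaleR order_trans zero_le_one)
  also have "\<dots> \<le> real (card J) * e"
    using small by (intro sum_norm_bound) (simp add: out)
  also have "\<dots> \<le> (real (card J) - 1) * (2 * e)"
    using mult_right_mono[OF n e] by (simp add: algebra_simps)
  finally have "norm s \<le> 2 * e" using n by (simp add: mult_le_cancel_left)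
  moreover have "norm (s - x j) \<le> e" using small[OF j] by (simp add: out[OF j])
  ultimately show ?thesis using norm_triangle_sub[of "x j" s] by (simp add: norm_minus_commute)
qed

text \<open>Sample \<open>n + 1\<close> independent points from \<open>\<mu>\<close>; each sum that leaves out one of them has the law
  \<open>mconv_pow \<mu> n\<close>, and if all these sums are small then so are the points.\<close>
lemma measure_norm_gt_le_mconv_pow:
  fixes \<mu> :: "'h::{real_normed_vector,second_countable_topology} measure"
  assumes \<mu>: "prob_space \<mu>" "sets \<mu> = sets borel" and n: "1 \<le> n"
  shows "measure \<mu> {x. 3 * e < norm x} \<le> (real n + 1) * measure (mconv_pow \<mu> n) {x. e < norm x}"
proof -
  note [measurable_cong] = \<mu>(2)
  interpret \<mu>: prob_space \<mu> by fact
  let ?Pi = "PiM {..n} (\<lambda>_. \<mu>)"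
  interpret Pi: product_prob_space "\<lambda>_. \<mu>" "{..n}" ..
  have law: "distr ?Pi borel (\<lambda>\<omega>. \<Sum>i\<in>J. \<omega> i) = mconv_pow \<mu> (card J)" if "J \<subseteq> {..n}" for J
  proof -
    have "distr \<mu> borel (\<lambda>x. x) = \<mu>" by (rule distr_id2[OF \<mu>(2)[symmetric]])
    then show ?thesis using \<mu>.distr_sum_PiM[of "\<lambda>x. x" J "{..n}"] that finite_subset[OF that]
      by simp
  qed
  have prob_eq: "measure (mconv_pow \<mu> (card J)) {x. c < norm x} =
      Pi.prob {\<omega>\<in>space ?Pi. c < norm (\<Sum>i\<in>J. \<omega> i)}" if "J \<subseteq> {..n}" for J c
    using that unfolding law[OF that, symmetric]
    by (subst measure_distr) (auto intro!: arg_cong[where f=Pi.prob] borel_measurable_sum)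
  let ?A = "\<lambda>j. {\<omega>\<in>space ?Pi. e < norm (\<Sum>i\<in>{..n} - {j}. \<omega> i)}"
  have A_meas: "?A j \<in> sets ?Pi" for j by measurable
  have "measure \<mu> {x. 3 * e < norm x} = Pi.prob {\<omega>\<in>space ?Pi. 3 * e < norm (\<omega> 0)}"
  proof -
    have "distr ?Pi \<mu> (\<lambda>\<omega>. \<omega> 0) = \<mu>" by (intro distr_PiM_component \<mu>) auto
    then have "measure \<mu> {x. 3 * e < norm x} = measure (distr ?Pi \<mu> (\<lambda>\<omega>. \<omega> 0)) {x. 3 * e < norm x}"
      by simp
    also have "\<dots> = Pi.prob {\<omega>\<in>space ?Pi. 3 * e < norm (\<omega> 0)}"
      by (subst measure_distr) (auto intro!: arg_cong[where f=Pi.prob])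
    finally show ?thesis .
  qed
  also have "\<dots> \<le> Pi.prob (\<Union>j\<le>n. ?A j)"
  proof (rule Pi.finite_measure_mono)
    show "{\<omega>\<in>space ?Pi. 3 * e < norm (\<omega> 0)} \<subseteq> (\<Union>j\<le>n. ?A j)"
      using norm_le_of_leave_one_out_sums[of "{..n}" _ e 0] n by (force simp: not_less)
  qed (use A_meas in auto)
  also have "\<dots> \<le> (\<Sum>j\<le>n. Pi.prob (?A j))"
    by (rule Pi.finite_measure_subadditive_finite) (use A_meas in auto)
  also have "\<dots> = (real n + 1) * measure (mconv_pow \<mu> n) {x. e < norm x}"
    by (simp add: prob_eq[of "{..n} - {_}", symmetric])
  finally show ?thesis .
qed

context prob_space
begin

lemma Cauchy_in_prob_mconv_root:
  fixes X U :: "nat \<Rightarrow> 'a \<Rightarrow> 'h::{real_normed_vector,second_countable_topology}"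
  assumes [measurable]: "\<And>k. X k \<in> borel_measurable M" "\<And>k. U k \<in> borel_measurable M"
    and n: "1 \<le> n"
    and law: "\<And>k l. k \<le> l \<Longrightarrow> distr M borel (\<lambda>\<omega>. X k \<omega> - X l \<omega>) =
      mconv_pow (distr M borel (\<lambda>\<omega>. U k \<omega> - U l \<omega>)) n"
    and X: "Cauchy_in_prob M X"
  shows "Cauchy_in_prob M U"
  unfolding Cauchy_in_prob_def
proof (intro allI impI)
  fix e :: real assume e: "0 < e"
  define \<epsilon> where "\<epsilon> = e / (real n + 3)"
  have \<epsilon>: "0 < \<epsilon>" "3 * \<epsilon> \<le> e" "(real n + 1) * \<epsilon> \<le> e" using e by (simp_all add: \<epsilon>_def field_simps)
  obtain N where N: "\<And>k l. k \<ge> N \<Longrightarrow> l \<ge> N \<Longrightarrow> prob {\<omega>\<in>space M. \<epsilon> < dist (X k \<omega>) (X l \<omega>)} < \<epsilon>"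
    using X \<epsilon>(1) unfolding Cauchy_in_prob_def by meson
  have tail: "prob {\<omega>\<in>space M. c < dist (W k \<omega>) (W l \<omega>)} =
      measure (distr M borel (\<lambda>\<omega>. W k \<omega> - W l \<omega>)) {x. c < norm x}"
    if [measurable]: "\<And>k. W k \<in> borel_measurable M" for W :: "nat \<Rightarrow> 'a \<Rightarrow> 'h" and k l c
    by (subst measure_distr) (auto intro!: arg_cong[where f=prob] simp: dist_norm)
  have ordered: "prob {\<omega>\<in>space M. e < dist (U k \<omega>) (U l \<omega>)} < e" if "N \<le> k" "k \<le> l" for k l
  proof -
    have "prob {\<omega>\<in>space M. e < dist (U k \<omega>) (U l \<omega>)} \<le>
        prob {\<omega>\<in>space M. 3 * \<epsilon> < dist (U k \<omega>) (U l \<omega>)}"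
      using \<epsilon>(2) by (intro finite_measure_mono) auto
    also have "\<dots> \<le> (real n + 1) * prob {\<omega>\<in>space M. \<epsilon> < dist (X k \<omega>) (X l \<omega>)}"
      unfolding tail[of U, OF assms(2)] tail[of X, OF assms(1)] law[OF that(2)]
      by (intro measure_norm_gt_le_mconv_pow n prob_space_distr) auto
    also have "\<dots> < (real n + 1) * \<epsilon>" using N[of k l] that by (intro mult_strict_left_mono) auto
    finally show ?thesis using \<epsilon>(3) by linarith
  qed
  have "prob {\<omega>\<in>space M. e < dist (U k \<omega>) (U l \<omega>)} < e" if "N \<le> k" "N \<le> l" for k l
    using ordered[of k l] ordered[of l k] that by (cases "k \<le> l") (simp_all add: dist_commute)
  then show "\<exists>N. \<forall>k\<ge>N. \<forall>l\<ge>N. prob {\<omega>\<in>space M. e < dist (U k \<omega>) (U l \<omega>)} < e" by blast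
qed

lemma mconv_root_of_limit_in_prob:
  fixes X U :: "nat \<Rightarrow> 'a \<Rightarrow> 'h::{real_normed_vector,complete_space,second_countable_topology}"
  assumes [measurable]: "\<And>k. X k \<in> borel_measurable M" "\<And>k. U k \<in> borel_measurable M"
      "Y \<in> borel_measurable M"
    and n: "1 \<le> n"
    and law: "\<And>k. distr M borel (X k) = mconv_pow (distr M borel (U k)) n"
    and diff_law: "\<And>k l. k \<le> l \<Longrightarrow> distr M borel (\<lambda>\<omega>. X k \<omega> - X l \<omega>) =
      mconv_pow (distr M borel (\<lambda>\<omega>. U k \<omega> - U l \<omega>)) n"
    and lim: "tendsto_in_prob M X Y"
  obtains \<mu> where "prob_space \<mu>" "sets \<mu> = sets borel" "distr M borel Y = mconv_pow \<mu> n"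
proof -
  obtain r where r: "strict_mono r" and X_lim: "AE \<omega> in M. (\<lambda>j. X (r j) \<omega>) \<longlonglongrightarrow> Y \<omega>"
    using lim by (rule tendsto_in_prob_AE_subseq[rotated 2]) auto
  have "Cauchy_in_prob M X" using lim by (rule tendsto_in_prob_imp_Cauchy[rotated 2]) auto
  with n diff_law have "Cauchy_in_prob M U"
    by (rule Cauchy_in_prob_mconv_root[of X U n, rotated 2]) auto
  then have "Cauchy_in_prob M (\<lambda>j. U (r j))" using r by (rule Cauchy_in_prob_subseq)
  then obtain q V where q: "strict_mono q" and [measurable]: "V \<in> borel_measurable M"
    and V: "AE \<omega> in M. (\<lambda>j. U (r (q j)) \<omega>) \<longlonglongrightarrow> V \<omega>"
    by (rule Cauchy_in_prob_AE_subseq[rotated]) auto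
  interpret Pi: product_prob_space "\<lambda>_. M" "{..<n}" ..
  let ?Pi = "PiM {..<n} (\<lambda>_. M)"
  have power: "distr ?Pi borel (\<lambda>\<omega>. \<Sum>i<n. W (\<omega> i)) = mconv_pow (distr M borel W) n"
    if "W \<in> borel_measurable M" for W :: "'a \<Rightarrow> 'h"
    using distr_sum_PiM[OF that, of "{..<n}" "{..<n}"] n by (auto simp: lessThan_empty_iff)
  have "distr M borel Y = distr ?Pi borel (\<lambda>\<omega>. \<Sum>i<n. V (\<omega> i))"
  proof (rule distr_eq_of_AE_limits[OF prob_space_axioms Pi.prob_space_axioms])
    show "AE \<omega> in M. (\<lambda>j. X (r (q j)) \<omega>) \<longlonglongrightarrow> Y \<omega>"
      using X_lim by eventually_elim (use LIMSEQ_subseq_LIMSEQ[OF _ q] in \<open>auto simp: comp_def\<close>)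
    have "AE \<omega> in ?Pi. (\<lambda>j. U (r (q j)) (\<omega> i)) \<longlonglongrightarrow> V (\<omega> i)" if "i < n" for i
      using V that by (intro AE_PiM_component prob_space_axioms) auto
    then have "AE \<omega> in ?Pi. \<forall>i\<in>{..<n}. (\<lambda>j. U (r (q j)) (\<omega> i)) \<longlonglongrightarrow> V (\<omega> i)"
      by (intro AE_finite_allI) auto
    then show "AE \<omega> in ?Pi. (\<lambda>j. \<Sum>i<n. U (r (q j)) (\<omega> i)) \<longlonglongrightarrow> (\<Sum>i<n. V (\<omega> i))"
      by eventually_elim (intro tendsto_sum, auto)
    show "distr M borel (X (r (q j))) = distr ?Pi borel (\<lambda>\<omega>. \<Sum>i<n. U (r (q j)) (\<omega> i))" for j
      by (simp add: power law)
  qed measurable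
  then have "distr M borel Y = mconv_pow (distr M borel V) n" by (simp add: power)
  then show thesis by (intro that[of "distr M borel V"]) (auto intro: prob_space_distr)
qed

end

section \<open>Riemann sums of a Levy process\<close>

lemma borel_measurable_bounded_linear:
  "bounded_linear T \<Longrightarrow> T \<in> borel_measurable borel"
  by (intro borel_measurable_continuous_onI linear_continuous_on)

locale levy_process_space =
  fixes P :: "'w measure"
    and Z :: "real \<Rightarrow> 'w \<Rightarrow> 'h::{real_inner,complete_space,second_countable_topology}"
  assumes levy: "levy_process P Z"

sublocale levy_process_space \<subseteq> prob_space P
  using levy by (simp add: levy_process_def)

context levy_process_space
begin

lemma Z_measurable: "0 \<le> s \<Longrightarrow> Z s \<in> borel_measurable P"
  using levy by (simp add: levy_process_def)

definition increment :: "real \<Rightarrow> nat \<Rightarrow> 'w \<Rightarrow> 'h" where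
  "increment \<delta> m \<omega> = Z (real (Suc m) * \<delta>) \<omega> - Z (real m * \<delta>) \<omega>"

definition riemann_sum :: "nat \<Rightarrow> real \<Rightarrow> (nat \<Rightarrow> 'h \<Rightarrow> 'h) \<Rightarrow> 'w \<Rightarrow> 'h" where
  "riemann_sum N \<delta> T \<omega> = (\<Sum>i<N. T i (increment \<delta> i \<omega>))"

lemma increment_measurable: "0 \<le> \<delta> \<Longrightarrow> increment \<delta> m \<in> borel_measurable P"
  unfolding increment_def by (intro borel_measurable_diff Z_measurable) auto

lemma riemann_sum_measurable:
  assumes "0 \<le> \<delta>" "\<And>i. i < N \<Longrightarrow> bounded_linear (T i)"
  shows "riemann_sum N \<delta> T \<in> borel_measurable P"
  unfolding riemann_sum_def[abs_def] using assms
  by (intro borel_measurable_sum measurable_compose[OF increment_measurable]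
      borel_measurable_bounded_linear) auto

lemma indep_increments:
  assumes "0 \<le> \<delta>"
  shows "indep_vars (\<lambda>_. borel) (increment \<delta>) {..<N}"
proof (cases "\<delta> = 0")
  case True
  then have "increment \<delta> = (\<lambda>_ _. 0)" by (simp add: increment_def fun_eq_iff)
  then show ?thesis by (simp add: indep_vars_const)
next
  case False
  have "\<forall>n (ts::nat \<Rightarrow> real). 0 \<le> ts 0 \<and> (\<forall>i<n. ts i < ts (Suc i)) \<longrightarrow>
      indep_vars (\<lambda>_. borel) (\<lambda>i \<omega>. Z (ts (Suc i)) \<omega> - Z (ts i) \<omega>) {..<n}"
    using levy by (simp add: levy_process_def)
  from this[rule_format, of "\<lambda>i. real i * \<delta>" N] show ?thesis
    using assms False by (simp add: increment_def[abs_def])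
qed

lemma distr_increment:
  assumes "0 \<le> \<delta>"
  shows "distr P borel (increment \<delta> m) = distr P borel (Z \<delta>)"
proof -
  have "\<forall>s\<ge>0. \<forall>t\<ge>0. distr P borel (\<lambda>\<omega>. Z (s + t) \<omega> - Z s \<omega>) = distr P borel (Z t)"
    using levy by (simp add: levy_process_def)
  from this[rule_format, of "real m * \<delta>" \<delta>] show ?thesis
    using assms by (simp add: increment_def[abs_def] algebra_simps)
qed

lemma increment_refine:
  "increment (real n * \<delta>) i \<omega> = (\<Sum>j<n. increment \<delta> (i * n + j) \<omega>)"
  using sum_lessThan_telescope[of "\<lambda>j. Z (real (i * n + j) * \<delta>) \<omega>" n]
  by (simp add: increment_def algebra_simps)

lemma riemann_sum_refine:
  assumes T: "\<And>i. i < N \<Longrightarrow> bounded_linear (T i)"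
  shows "riemann_sum N (real n * \<delta>) T \<omega> = riemann_sum (N * n) \<delta> (\<lambda>i. T (i div n)) \<omega>"
proof -
  have "riemann_sum N (real n * \<delta>) T \<omega> = (\<Sum>i<N. \<Sum>j<n. T i (increment \<delta> (i * n + j) \<omega>))"
    unfolding riemann_sum_def increment_refine
    by (intro sum.cong refl linear_sum bounded_linear.linear[OF T]) simp
  also have "\<dots> = (\<Sum>i<N. \<Sum>k\<in>{i * n..<i * n + n}. T (k div n) (increment \<delta> k \<omega>))"
  proof (rule sum.cong[OF refl])
    fix i
    have "(\<Sum>k\<in>{i * n..<i * n + n}. T (k div n) (increment \<delta> k \<omega>)) =
        (\<Sum>k\<in>(+) (i * n) ` {..<n}. T (k div n) (increment \<delta> k \<omega>))"
      by (simp add: lessThan_atLeast0 add.commute[of n])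
    also have "\<dots> = (\<Sum>j<n. T i (increment \<delta> (i * n + j) \<omega>))" by (simp add: sum.reindex)
    finally show "(\<Sum>j<n. T i (increment \<delta> (i * n + j) \<omega>)) =
        (\<Sum>k\<in>{i * n..<i * n + n}. T (k div n) (increment \<delta> k \<omega>))" ..
  qed
  also have "\<dots> = riemann_sum (N * n) \<delta> (\<lambda>i. T (i div n)) \<omega>"
    unfolding riemann_sum_def by (rule sum.nat_group)
  finally show ?thesis .
qed

lemma distr_riemann_sum_mult:
  assumes \<delta>: "0 \<le> \<delta>" and T: "\<And>i. i < N \<Longrightarrow> bounded_linear (T i)"
  shows "distr P borel (riemann_sum N (real n * \<delta>) T) =
    mconv_pow (distr P borel (riemann_sum N \<delta> T)) n"
proof -
  let ?X = "\<lambda>(i, j). increment \<delta> (i * n + j)"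
  have "indep_vars (\<lambda>_. borel) (\<lambda>p. increment \<delta> (fst p * n + snd p)) ({..<N} \<times> {..<n})"
  proof (rule indep_vars_inj[OF indep_increments[OF \<delta>]])
    show "(\<lambda>p. fst p * n + snd p) ` ({..<N} \<times> {..<n}) \<subseteq> {..<N * n}"
      by (auto simp flip: div_less_iff_less_mult)
    show "inj_on (\<lambda>p. fst p * n + snd p) ({..<N} \<times> {..<n})"
    proof (rule inj_on_inverseI)
      show "(\<lambda>k. (k div n, k mod n)) (fst p * n + snd p) = p" if "p \<in> {..<N} \<times> {..<n}" for p
        using that by auto
    qed
  qed
  then have "indep_vars (\<lambda>_. borel) ?X ({..<N} \<times> {..<n})" by (simp add: case_prod_unfold)
  then have "distr P borel (\<lambda>\<omega>. \<Sum>i<N. T i (\<Sum>j<n. ?X (i, j) \<omega>)) =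
      mconv_pow (distr P borel (\<lambda>\<omega>. \<Sum>i<N. T i (increment \<delta> i \<omega>))) (card {..<n})"
    by (rule distr_linear_grid_sum)
       (use T in \<open>auto simp: distr_increment[OF \<delta>] intro: indep_increments[OF \<delta>]\<close>)
  then show ?thesis by (simp add: riemann_sum_def[abs_def] increment_refine)
qed

end

section \<open>Dyadic approximation of the stochastic convolution\<close>

context levy_process_space
begin

text \<open>The factor \<open>c\<close> only scales the process: these are the Riemann sums of \<open>s \<mapsto> Z (c * s)\<close> over
  \<open>{0..t}\<close>. The roots of the law for \<open>c = 1\<close> come from the values \<open>c = 1 / n\<close>.\<close>
definition dyadic_sum :: "(real \<Rightarrow> 'h \<Rightarrow> 'h) \<Rightarrow> real \<Rightarrow> real \<Rightarrow> nat \<Rightarrow> 'w \<Rightarrow> 'h" where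
  "dyadic_sum F t c k = riemann_sum (2^k) (c * (t / 2^k)) (\<lambda>i. F (real i * (t / 2^k)))"

lemma dyadic_point_in_interval:
  assumes "0 \<le> t" "i < 2^k"
  shows "real i * (t / 2^k) \<in> {0..t}"
proof -
  have "real i \<le> 2^k" using assms(2)
    by (metis of_nat_le_iff of_nat_numeral of_nat_power less_imp_le)
  then show ?thesis using mult_right_mono[of "real i" "2^k" t] assms(1) by (simp add: field_simps)
qed

lemma dyadic_sum_measurable:
  assumes "0 \<le> t" "0 \<le> c" and F: "\<And>s. s \<in> {0..t} \<Longrightarrow> bounded_linear (F s)"
  shows "dyadic_sum F t c k \<in> borel_measurable P"
  unfolding dyadic_sum_def using assms
  by (intro riemann_sum_measurable F dyadic_point_in_interval) auto

lemma dyadic_sum_diff: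
  assumes t: "0 \<le> t" and F: "\<And>s. s \<in> {0..t} \<Longrightarrow> bounded_linear (F s)" and kl: "k \<le> l"
  obtains W where "\<And>i. i < 2^l \<Longrightarrow> bounded_linear (W i)"
    "\<And>c \<omega>. dyadic_sum F t c k \<omega> - dyadic_sum F t c l \<omega> = riemann_sum (2^l) (c * (t / 2^l)) W \<omega>"
proof
  define q :: nat where "q = 2^(l - k)"
  have q: "2^l = 2^k * q" "(2::real)^l = 2^k * real q" "0 < q"
    using kl by (simp_all add: q_def flip: power_add)
  define W where "W i x = F (real (i div q) * (t / 2^k)) x - F (real i * (t / 2^l)) x" for i x
  have coarse: "i div q < 2^k" if "i < 2^l" for i using that q by (simp add: less_mult_imp_div_less)
  show "bounded_linear (W i)" if "i < 2^l" for i
    unfolding W_def[abs_def] using that coarse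
    by (intro bounded_linear_sub F dyadic_point_in_interval t) auto
  fix c \<omega>
  have step: "c * (t / 2^k) = real q * (c * (t / 2^l))" using q by simp
  have "dyadic_sum F t c k \<omega> =
      riemann_sum (2^k * q) (c * (t / 2^l)) (\<lambda>i. F (real (i div q) * (t / 2^k))) \<omega>"
    unfolding dyadic_sum_def step by (intro riemann_sum_refine F dyadic_point_in_interval t)
  then show "dyadic_sum F t c k \<omega> - dyadic_sum F t c l \<omega> = riemann_sum (2^l) (c * (t / 2^l)) W \<omega>"
    by (simp add: dyadic_sum_def riemann_sum_def W_def sum_subtractf q(1))
qed

lemma infinitely_divisible_of_dyadic_limit:
  assumes t: "0 \<le> t" and F: "\<And>s. s \<in> {0..t} \<Longrightarrow> bounded_linear (F s)"
    and Y: "Y \<in> borel_measurable P" and lim: "tendsto_in_prob P (dyadic_sum F t 1) Y"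
  shows "infinitely_divisible P Y"
  unfolding infinitely_divisible_def
proof (intro allI impI)
  fix n :: nat assume n: "1 \<le> n"
  have scale: "1 * (t / 2^k) = real n * (1 / real n * (t / 2^k))" for k using n by simp
  have law: "distr P borel (dyadic_sum F t 1 k) =
      mconv_pow (distr P borel (dyadic_sum F t (1 / real n) k)) n" for k
    unfolding dyadic_sum_def scale using t F dyadic_point_in_interval[OF t]
    by (intro distr_riemann_sum_mult) auto
  have diff_law: "distr P borel (\<lambda>\<omega>. dyadic_sum F t 1 k \<omega> - dyadic_sum F t 1 l \<omega>) =
      mconv_pow (distr P borel
        (\<lambda>\<omega>. dyadic_sum F t (1 / real n) k \<omega> - dyadic_sum F t (1 / real n) l \<omega>)) n"
    if kl: "k \<le> l" for k l
  proof -
    obtain W where W: "\<And>i. i < 2^l \<Longrightarrow> bounded_linear (W i)"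
      "\<And>c \<omega>. dyadic_sum F t c k \<omega> - dyadic_sum F t c l \<omega> = riemann_sum (2^l) (c * (t / 2^l)) W \<omega>"
      using dyadic_sum_diff[where F=F, OF t F kl] by blast
    show ?thesis unfolding W(2) scale using t W(1) by (intro distr_riemann_sum_mult) auto
  qed
  have meas: "dyadic_sum F t c k \<in> borel_measurable P" if "0 \<le> c" for c k
    using t that F by (rule dyadic_sum_measurable)
  obtain \<mu> where "prob_space \<mu>" "sets \<mu> = sets borel" "distr P borel Y = mconv_pow \<mu> n"
    by (rule mconv_root_of_limit_in_prob[OF meas meas Y n law diff_law lim]) simp_all
  then show "\<exists>\<mu>. prob_space \<mu> \<and> sets \<mu> = sets borel \<and> distr P borel Y = mconv_pow \<mu> n" by blast
qed

lemma conv_sum_uniform: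
  assumes t: "real n * h = t"
  shows "conv_sum R Z t n (\<lambda>i. real i * h) (\<lambda>i. real i * h) \<omega> =
    riemann_sum n h (\<lambda>i. R (t - real i * h)) \<omega>"
  unfolding conv_sum_def riemann_sum_def increment_def
proof (rule sum.reindex_bij_witness[of _ "\<lambda>j. n - j" "\<lambda>i. n - i"])
  fix i assume "i \<in> {1..n}"
  then have "t - real (n - i) * h = real i * h" "real (Suc (n - i)) * h = t - real (i - 1) * h"
    "real (n - i) * h = t - real i * h"
    by (auto simp: of_nat_diff algebra_simps t[symmetric])
  then show "R (t - real (n - i) * h) (Z (real (Suc (n - i)) * h) \<omega> - Z (real (n - i) * h) \<omega>) =
      R (real i * h) (Z (t - real (i - 1) * h) \<omega> - Z (t - real i * h) \<omega>)" by simp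
qed auto

lemma dyadic_sum_tendsto_stoch_conv:
  assumes t: "0 \<le> t" and R0: "bounded_linear (R 0)" and Y: "Y \<in> borel_measurable P"
    and conv: "is_stoch_conv P R Z t Y"
  shows "tendsto_in_prob P (dyadic_sum (\<lambda>s. R (t - s)) t 1) Y"
proof (cases "t = 0")
  case True
  have "R 0 0 = 0" using R0 by (simp add: linear_0 bounded_linear.linear)
  then have zero: "dyadic_sum (\<lambda>s. R (t - s)) t 1 k \<omega> = 0" for k \<omega>
    by (simp add: dyadic_sum_def riemann_sum_def increment_def True)
  have "prob {\<omega>\<in>space P. e < dist 0 (Y \<omega>)} = 0" if "0 < e" for e
  proof -
    have "AE \<omega> in P. Y \<omega> = 0" using conv True by (simp add: is_stoch_conv_def)
    then have "AE \<omega> in P. \<omega> \<notin> {\<omega>\<in>space P. e < dist 0 (Y \<omega>)}" by eventually_elim (use that in auto)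
    then show ?thesis using Y by (subst prob_eq_0) auto
  qed
  then show ?thesis by (simp add: tendsto_in_prob_def zero)
next
  case False
  show ?thesis
    unfolding tendsto_in_prob_def
  proof (intro allI impI)
    fix e :: real assume "0 < e"
    then obtain \<delta> where \<delta>: "0 < \<delta>" "\<And>n ts ss. tagged_partition t \<delta> n ts ss \<Longrightarrow>
        prob {\<omega>\<in>space P. e < dist (conv_sum R Z t n ts ss \<omega>) (Y \<omega>)} < e"
      using conv False unfolding is_stoch_conv_def by auto
    have "(\<lambda>k. t * (1/2)^k) \<longlonglongrightarrow> t * 0" by (intro tendsto_intros LIMSEQ_power_zero) simp
    then have "(\<lambda>k. t / 2^k) \<longlonglongrightarrow> 0" by (simp add: power_one_over)
    then have "\<forall>\<^sub>F k in sequentially. t / 2^k < \<delta>" using \<delta>(1) by (rule order_tendstoD)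
    then obtain N where N: "\<And>k. k \<ge> N \<Longrightarrow> t / 2^k < \<delta>" by (auto simp: eventually_sequentially)
    have "prob {\<omega>\<in>space P. e < dist (dyadic_sum (\<lambda>s. R (t - s)) t 1 k \<omega>) (Y \<omega>)} < e"
      if "k \<ge> N" for k
    proof -
      define h where "h = t / 2^k"
      have h: "0 < h" "h < \<delta>" "real (2^k) * h = t" using N[OF that] t False by (simp_all add: h_def)
      then have "tagged_partition t \<delta> (2^k) (\<lambda>i. real i * h) (\<lambda>i. real i * h)"
        by (auto simp: tagged_partition_def of_nat_diff algebra_simps)
      from \<delta>(2)[OF this] show ?thesis
        by (simp add: conv_sum_uniform[OF h(3)] dyadic_sum_def flip: h_def)
    qed
    then show "\<exists>N. \<forall>k\<ge>N. prob {\<omega>\<in>space P. e < dist (dyadic_sum (\<lambda>s. R (t - s)) t 1 k \<omega>) (Y \<omega>)} < e"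
      by blast
  qed
qed

end

section \<open>Characteristic functionals and Levy exponents\<close>

definition char_functional :: "'a measure \<Rightarrow> ('a \<Rightarrow> 'h::real_inner) \<Rightarrow> 'h \<Rightarrow> complex" where
  "char_functional P X y = (LINT \<omega>|P. iexp (inner y (X \<omega>)))"

lemma char_functional_cong_distr:
  fixes X :: "'a \<Rightarrow> 'h::{real_inner,second_countable_topology}"
  assumes [measurable]: "X \<in> borel_measurable P" "X' \<in> borel_measurable P'"
    and eq: "distr P borel X = distr P' borel X'"
  shows "char_functional P X = char_functional P' X'"
proof
  fix y :: 'h
  have "char_functional P X y = (LINT x|distr P borel X. iexp (inner y x))"
    by (simp add: char_functional_def integral_distr)
  also have "\<dots> = char_functional P' X' y"
    unfolding eq by (simp add: char_functional_def integral_distr)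
  finally show "char_functional P X y = char_functional P' X' y" .
qed

context prob_space
begin

lemma integral_iexp_tendsto:
  assumes [measurable]: "\<And>k. f k \<in> borel_measurable M" "g \<in> borel_measurable M"
    and lim: "AE \<omega> in M. (\<lambda>k. f k \<omega>) \<longlonglongrightarrow> g \<omega>"
  shows "(\<lambda>k. LINT \<omega>|M. iexp (f k \<omega>)) \<longlonglongrightarrow> (LINT \<omega>|M. iexp (g \<omega>))"
proof (rule integral_dominated_convergence[where w="\<lambda>_. 1"])
  show "AE \<omega> in M. (\<lambda>k. iexp (f k \<omega>)) \<longlonglongrightarrow> iexp (g \<omega>)"
    using lim by eventually_elim (intro tendsto_intros)
qed auto

lemma char_functional_sum_indep:
  fixes X :: "'i \<Rightarrow> 'a \<Rightarrow> 'h::{real_inner,complete_space,second_countable_topology}"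
  assumes X: "indep_vars (\<lambda>_. borel) X I" and I: "finite I"
    and T: "\<And>i. i \<in> I \<Longrightarrow> bounded_linear (T i)"
  shows "char_functional M (\<lambda>\<omega>. \<Sum>i\<in>I. T i (X i \<omega>)) y =
    (\<Prod>i\<in>I. char_functional M (X i) (hadj (T i) y))"
proof -
  let ?E = "\<lambda>i \<omega>. iexp (inner (hadj (T i) y) (X i \<omega>))"
  have "inner y (\<Sum>i\<in>I. T i (X i \<omega>)) = (\<Sum>i\<in>I. inner (hadj (T i) y) (X i \<omega>))" for \<omega>
    by (simp add: inner_sum_right inner_hadj_left T)
  then have "char_functional M (\<lambda>\<omega>. \<Sum>i\<in>I. T i (X i \<omega>)) y = (LINT \<omega>|M. (\<Prod>i\<in>I. ?E i \<omega>))"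
    by (simp add: char_functional_def exp_sum sum_distrib_left I)
  also have "\<dots> = (\<Prod>i\<in>I. LINT \<omega>|M. ?E i \<omega>)"
  proof (rule indep_vars_lebesgue_integral[OF I])
    show "indep_vars (\<lambda>_. borel) ?E I" by (rule indep_vars_compose2[OF X]) measurable
    fix i assume "i \<in> I"
    then have [measurable]: "X i \<in> borel_measurable M" using X by (simp add: indep_vars_def)
    show "integrable M (?E i)" by (rule integrable_const_bound[where B=1]) auto
  qed
  finally show ?thesis by (simp add: char_functional_def)
qed

end

definition levy_kernel :: "'h::real_inner \<Rightarrow> 'h \<Rightarrow> complex" where
  "levy_kernel y x = iexp (inner y x) - 1
    - \<i> * complex_of_real (inner y x) * complex_of_real (indicator {x. norm x < 1} x)"

definition levy_exponent :: "'h::real_inner \<Rightarrow> ('h \<Rightarrow> 'h) \<Rightarrow> 'h measure \<Rightarrow> 'h \<Rightarrow> complex" where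
  "levy_exponent a \<Theta> M y = \<i> * complex_of_real (inner a y) - complex_of_real (inner (\<Theta> y) y / 2)
    + (LINT x|M. levy_kernel y x)"

lemma levy_char_iff:
  "levy_char P X a \<Theta> M \<longleftrightarrow> (\<forall>y. char_functional P X y = exp (levy_exponent a \<Theta> M y))"
  by (simp add: levy_char_def char_functional_def levy_exponent_def levy_kernel_def)

lemma levy_kernel_measurable [measurable]:
  fixes y :: "'h::{real_inner,second_countable_topology}"
  shows "levy_kernel y \<in> borel_measurable borel"
  unfolding levy_kernel_def[abs_def] by measurable

lemma levy_kernel_zero [simp]: "levy_kernel y 0 = 0"
  by (simp add: levy_kernel_def)

lemma norm_levy_kernel_le:
  "cmod (levy_kernel y x) \<le> (2 + (norm y)\<^sup>2) * min 1 ((norm x)\<^sup>2)"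
proof (cases "norm x < 1")
  case True
  have "cmod (levy_kernel y x) = cmod (iexp (inner y x) - (\<Sum>k\<le>1. (\<i> * inner y x)^k / fact k))"
    using True by (simp add: levy_kernel_def diff_diff_eq)
  also have "\<dots> \<le> \<bar>inner y x\<bar>^2 / 2"
    using iexp_approx1[of "inner y x" 1] by (simp add: numeral_2_eq_2)
  also have "\<dots> \<le> (norm y * norm x)^2 / 2"
    by (intro divide_right_mono power_mono Cauchy_Schwarz_ineq2) auto
  also have "\<dots> \<le> (2 + (norm y)\<^sup>2) * (norm x)\<^sup>2"
    by (simp add: power_mult_distrib algebra_simps)
  finally show ?thesis using True by (simp add: min_absorb2 power_le_one)
next
  case False
  then have "cmod (levy_kernel y x) \<le> 2"
    using norm_triangle_ineq4[of "iexp (inner y x)" 1] by (simp add: levy_kernel_def)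
  moreover have "min 1 ((norm x)\<^sup>2) = 1" using False by (simp add: min_def one_le_power)
  ultimately show ?thesis by (simp add: add_increasing2)
qed

lemma levy_exponent_scale:
  assumes s: "0 \<le> s" and M: "sets M = sets borel"
  shows "levy_exponent (s *\<^sub>R a) (\<lambda>y. s *\<^sub>R \<Theta> y) (scale_measure (ennreal s) M) y =
    complex_of_real s * levy_exponent a \<Theta> M (y::'h::{real_inner,second_countable_topology})"
proof -
  note [measurable_cong] = M
  have "scale_measure (ennreal s) M = density M (\<lambda>_. ennreal s)"
    by (rule measure_eqI) (auto simp: emeasure_density nn_integral_cmult_indicator)
  then have "(LINT x|scale_measure (ennreal s) M. levy_kernel y x) =
      complex_of_real s * (LINT x|M. levy_kernel y x)"
    using s by (simp add: integral_density scaleR_conv_of_real)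
  then show ?thesis by (simp add: levy_exponent_def algebra_simps)
qed

locale levy_measure_space =
  fixes M :: "'h::{real_inner,complete_space,second_countable_topology} measure"
  assumes levy_measure: "levy_measure M"
begin

lemma sets_M [measurable_cong, simp]: "sets M = sets borel"
  using levy_measure by (simp add: levy_measure_def)

lemma space_M [simp]: "space M = UNIV"
  using sets_eq_imp_space_eq[OF sets_M] by simp

lemma integrable_min_norm: "integrable M (\<lambda>x. min 1 ((norm x)\<^sup>2))"
  using levy_measure by (intro integrableI_bounded) (auto simp: levy_measure_def)

lemma sigma_finite_M: "sigma_finite_measure M"
proof
  let ?g = "\<lambda>x::'h. ennreal (min 1 ((norm x)\<^sup>2))"
  let ?A = "\<lambda>n::nat. {x\<in>space M. 1 \<le> of_nat n * ?g x}"
  have g: "integral\<^sup>N M ?g < \<infinity>" using levy_measure by (simp add: levy_measure_def)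
  have "emeasure M (?A n) \<noteq> \<infinity>" for n
  proof -
    have "emeasure M (?A n) \<le> of_nat n * (\<integral>\<^sup>+x. ?g x * indicator (space M) x \<partial>M)"
      by (rule nn_integral_Markov_inequality) auto
    also have "\<dots> < \<infinity>" using g by (simp add: ennreal_mult_less_top of_nat_less_top)
    finally show ?thesis by simp
  qed
  moreover have "x \<in> {0} \<union> (\<Union>n. ?A n)" for x
  proof (cases "x = 0")
    case False
    then have "0 < min 1 ((norm x)\<^sup>2)" by simp
    then obtain n where "1 < real n * min 1 ((norm x)\<^sup>2)" using ex_less_of_nat_mult by blast
    then have "1 \<le> of_nat n * ?g x"
      by (simp add: ennreal_of_nat_eq_real_of_nat ennreal_mult'[symmetric] ennreal_1[symmetric]
          del: ennreal_1)
    then show ?thesis by auto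
  qed simp
  moreover have "emeasure M {0} \<noteq> \<infinity>" using levy_measure by (simp add: levy_measure_def)
  ultimately show "\<exists>A. countable A \<and> A \<subseteq> sets M \<and> \<Union>A = space M \<and> (\<forall>a\<in>A. emeasure M a \<noteq> \<infinity>)"
    by (intro exI[of _ "insert {0} (range ?A)"]) auto
qed

lemma integral_levy_kernel_weakly_continuous:
  assumes weak: "\<And>x. (\<lambda>m. inner (z m) x) \<longlonglongrightarrow> inner z0 x" and bound: "\<And>m. norm (z m) \<le> B"
  shows "(\<lambda>m. LINT x|M. levy_kernel (z m) x) \<longlonglongrightarrow> (LINT x|M. levy_kernel z0 x)"
proof (rule integral_dominated_convergence[where w="\<lambda>x. (2 + B\<^sup>2) * min 1 ((norm x)\<^sup>2)"])
  show "integrable M (\<lambda>x. (2 + B\<^sup>2) * min 1 ((norm x)\<^sup>2))" using integrable_min_norm by simp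
  show "AE x in M. (\<lambda>m. levy_kernel (z m) x) \<longlonglongrightarrow> levy_kernel z0 x"
    unfolding levy_kernel_def by (intro AE_I2 tendsto_intros weak)
  show "AE x in M. norm (levy_kernel (z m) x) \<le> (2 + B\<^sup>2) * min 1 ((norm x)\<^sup>2)" for m
  proof (rule AE_I2)
    fix x :: 'h
    have "(2 + (norm (z m))\<^sup>2) * min 1 ((norm x)\<^sup>2) \<le> (2 + B\<^sup>2) * min 1 ((norm x)\<^sup>2)"
      using bound[of m] by (intro mult_right_mono add_left_mono power_mono) auto
    with norm_levy_kernel_le show "norm (levy_kernel (z m) x) \<le> (2 + B\<^sup>2) * min 1 ((norm x)\<^sup>2)"
      by (rule order_trans)
  qed
qed simp_all

text \<open>The Gaussian part is recovered from the modulus of the characteristic functional, whose weak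
  sequential continuity is plain dominated convergence.\<close>
lemma levy_exponent_weakly_continuous:
  assumes P: "prob_space P" and X [measurable]: "X \<in> borel_measurable P"
    and char: "levy_char P X a \<Theta> M"
    and weak: "\<And>x. (\<lambda>m. inner (z m) x) \<longlonglongrightarrow> inner z0 x" and bound: "\<And>m. norm (z m) \<le> B"
  shows "(\<lambda>m. levy_exponent a \<Theta> M (z m)) \<longlonglongrightarrow> levy_exponent a \<Theta> M z0"
proof -
  let ?\<psi> = "levy_exponent a \<Theta> M"
  let ?q = "\<lambda>y. inner (\<Theta> y) y / 2"
  note jumps = integral_levy_kernel_weakly_continuous[OF weak bound]
  have "(\<lambda>m. char_functional P X (z m)) \<longlonglongrightarrow> char_functional P X z0"
    unfolding char_functional_def
    by (intro prob_space.integral_iexp_tendsto[OF P] AE_I2 weak) simp_all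
  then have "(\<lambda>m. exp (?\<psi> (z m))) \<longlonglongrightarrow> exp (?\<psi> z0)" using char by (simp add: levy_char_iff)
  then have "(\<lambda>m. ln (cmod (exp (?\<psi> (z m))))) \<longlonglongrightarrow> ln (cmod (exp (?\<psi> z0)))"
    by (rule tendsto_ln[OF tendsto_norm]) simp
  then have "(\<lambda>m. Re (?\<psi> (z m))) \<longlonglongrightarrow> Re (?\<psi> z0)" by simp
  from tendsto_diff[OF tendsto_Re[OF jumps] this] have gauss: "(\<lambda>m. ?q (z m)) \<longlonglongrightarrow> ?q z0"
    by (simp add: levy_exponent_def)
  have "(\<lambda>m. \<i> * complex_of_real (inner (z m) a) - complex_of_real (?q (z m))
        + (LINT x|M. levy_kernel (z m) x))
      \<longlonglongrightarrow> \<i> * complex_of_real (inner z0 a) - complex_of_real (?q z0) + (LINT x|M. levy_kernel z0 x)"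
    by (intro tendsto_intros weak gauss jumps)
  then show ?thesis by (simp add: levy_exponent_def inner_commute[of _ a])
qed

end

section \<open>Limits of characteristic functionals of Riemann sums\<close>

lemma sum_integral_uniform_grid:
  fixes f :: "real \<Rightarrow> 'b::banach"
  assumes "0 \<le> h" "f integrable_on {0..real n * h}"
  shows "(\<Sum>i<n. integral {real i * h..real (Suc i) * h} f) = integral {0..real n * h} f"
  using assms(2)
proof (induction n)
  case (Suc n)
  have le: "0 \<le> real n * h" "real n * h \<le> real (Suc n) * h" using assms(1)
    by (auto intro: mult_right_mono)
  then have "f integrable_on {0..real n * h}"
    by (intro integrable_on_subinterval[OF Suc.prems]) auto
  then show ?case
    using Suc.IH Henstock_Kurzweil_Integration.integral_combine[OF le Suc.prems] by simp
qed simp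

lemma riemann_sum_integral_error:
  fixes f :: "real \<Rightarrow> 'b::banach"
  assumes f: "continuous_on {0..t} f" and h: "0 \<le> h" "real n * h = t"
    and osc: "\<And>u v. u \<in> {0..t} \<Longrightarrow> v \<in> {0..t} \<Longrightarrow> \<bar>v - u\<bar> \<le> h \<Longrightarrow> norm (f u - f v) \<le> e"
  shows "norm (h *\<^sub>R (\<Sum>i<n. f (real i * h)) - integral {0..t} f) \<le> t * e"
proof -
  let ?I = "\<lambda>i. {real i * h..real (Suc i) * h}"
  have grid: "0 \<le> real i * h" "real i * h \<le> real (Suc i) * h" "real (Suc i) * h \<le> t"
    if "i < n" for i
    using that h mult_right_mono[of "real (Suc i)" "real n" h] by (auto simp: mult_right_mono)
  have sub: "?I i \<subseteq> {0..t}" if "i < n" for i using grid[OF that] by auto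
  have int: "f integrable_on S" if "S = {u..v}" "S \<subseteq> {0..t}" for S u v
    using that continuous_on_subset[OF f] integrable_continuous_interval by blast
  have "(\<Sum>i<n. integral (?I i) f) = integral {0..t} f"
    using sum_integral_uniform_grid[OF h(1), of f n] int[OF refl order_refl] by (simp add: h(2))
  then have "h *\<^sub>R (\<Sum>i<n. f (real i * h)) - integral {0..t} f =
      (\<Sum>i<n. h *\<^sub>R f (real i * h) - integral (?I i) f)"
    by (simp add: scaleR_sum_right sum_subtractf)
  also have "norm \<dots> \<le> (\<Sum>i<n. h * e)"
  proof (rule sum_norm_le)
    fix i assume "i \<in> {..<n}"
    then have i: "i < n" by simp
    have "h *\<^sub>R f (real i * h) - integral (?I i) f = integral (?I i) (\<lambda>v. f (real i * h) - f v)"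
      using grid[OF i] int[OF refl sub[OF i]] by (subst integral_diff) (auto simp: algebra_simps)
    also have "norm \<dots> \<le> e * (real (Suc i) * h - real i * h)"
    proof (rule integral_bound)
      show "continuous_on (?I i) (\<lambda>v. f (real i * h) - f v)"
        by (intro continuous_intros continuous_on_subset[OF f sub[OF i]])
      show "norm (f (real i * h) - f v) \<le> e" if "v \<in> ?I i" for v
      proof (rule osc)
        show "real i * h \<in> {0..t}" "v \<in> {0..t}" using that sub[OF i] grid[OF i] by auto
        show "\<bar>v - real i * h\<bar> \<le> h" using that by (auto simp: algebra_simps)
      qed
    qed (rule grid[OF i])
    finally show "norm (h *\<^sub>R f (real i * h) - integral (?I i) f) \<le> h * e"
      by (simp add: algebra_simps)
  qed
  also have "\<dots> = t * e" by (simp add: h(2)[symmetric])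
  finally show ?thesis .
qed

lemma riemann_sums_tendsto_integral:
  fixes f :: "real \<Rightarrow> 'b::banach"
  assumes t: "0 \<le> t" and f: "continuous_on {0..t} f"
  shows "(\<lambda>n. (t / real n) *\<^sub>R (\<Sum>i<n. f (real i * (t / real n)))) \<longlonglongrightarrow> integral {0..t} f"
proof (rule metric_LIMSEQ_I)
  fix e :: real assume e: "0 < e"
  define \<epsilon> where "\<epsilon> = e / (t + 1)"
  have \<epsilon>: "0 < \<epsilon>" "t * \<epsilon> < e" using e t by (simp_all add: \<epsilon>_def field_simps)
  have "uniformly_continuous_on {0..t} f" using f compact_uniformly_continuous compact_Icc by blast
  then obtain d where d: "0 < d"
    "\<And>u v. u \<in> {0..t} \<Longrightarrow> v \<in> {0..t} \<Longrightarrow> \<bar>v - u\<bar> < d \<Longrightarrow> norm (f u - f v) < \<epsilon>"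
    using \<epsilon>(1) unfolding uniformly_continuous_on_def dist_norm real_norm_def
    by (metis norm_minus_commute)
  obtain n0 where n0: "t / d < real n0" using reals_Archimedean2 by blast
  show "\<exists>n0. \<forall>n\<ge>n0.
      dist ((t / real n) *\<^sub>R (\<Sum>i<n. f (real i * (t / real n)))) (integral {0..t} f) < e"
  proof (intro exI[of _ n0] allI impI)
    fix n assume "n \<ge> n0"
    then have "t / d < real n" using n0 by simp
    then have n: "0 < real n" "t / real n < d"
      using divide_nonneg_pos[OF t d(1)] d(1) by (linarith, simp add: divide_less_eq mult.commute)
    have "norm ((t / real n) *\<^sub>R (\<Sum>i<n. f (real i * (t / real n))) - integral {0..t} f) \<le> t * \<epsilon>"
    proof (rule riemann_sum_integral_error[OF f])
      show "norm (f u - f v) \<le> \<epsilon>" if "u \<in> {0..t}" "v \<in> {0..t}" "\<bar>v - u\<bar> \<le> t / real n" for u v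
        using d(2)[OF that(1,2)] that(3) n(2) by simp
    qed (use n t in auto)
    then show "dist ((t / real n) *\<^sub>R (\<Sum>i<n. f (real i * (t / real n)))) (integral {0..t} f) < e"
      using \<epsilon>(2) by (simp add: dist_norm)
  qed
qed

context levy_process_space
begin

lemma char_functional_riemann_sum:
  assumes \<delta>: "0 \<le> \<delta>" and T: "\<And>i. i < N \<Longrightarrow> bounded_linear (T i)"
    and char: "\<And>y. char_functional P (Z \<delta>) y = exp (complex_of_real \<delta> * \<psi> y)"
  shows "char_functional P (riemann_sum N \<delta> T) y = exp (\<delta> *\<^sub>R (\<Sum>i<N. \<psi> (hadj (T i) y)))"
proof -
  have increment: "char_functional P (increment \<delta> i) = char_functional P (Z \<delta>)" for i
    using \<delta> by (intro char_functional_cong_distr increment_measurable Z_measurable distr_increment)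
  have "char_functional P (riemann_sum N \<delta> T) y =
      (\<Prod>i<N. char_functional P (increment \<delta> i) (hadj (T i) y))"
    unfolding riemann_sum_def[abs_def]
    by (rule char_functional_sum_indep[OF indep_increments[OF \<delta>]]) (simp_all add: T)
  then show ?thesis by (simp add: increment char exp_sum scaleR_conv_of_real sum_distrib_left)
qed

lemma char_functional_of_dyadic_limit:
  assumes t: "0 \<le> t" and F: "\<And>s. s \<in> {0..t} \<Longrightarrow> bounded_linear (F s)"
    and Y [measurable]: "Y \<in> borel_measurable P" and lim: "tendsto_in_prob P (dyadic_sum F t 1) Y"
    and char: "\<And>s y. 0 \<le> s \<Longrightarrow> char_functional P (Z s) y = exp (complex_of_real s * \<psi> y)"
    and cont: "continuous_on {0..t} (\<lambda>s. \<psi> (hadj (F s) y))"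
  shows "char_functional P Y y = exp (integral {0..t} (\<lambda>s. \<psi> (hadj (F s) y)))"
proof -
  have [measurable]: "dyadic_sum F t 1 k \<in> borel_measurable P" for k
    using t F by (intro dyadic_sum_measurable) auto
  obtain r where r: "strict_mono r" and AE_lim: "AE \<omega> in P. (\<lambda>j. dyadic_sum F t 1 (r j) \<omega>) \<longlonglongrightarrow> Y \<omega>"
    using lim by (rule tendsto_in_prob_AE_subseq[rotated 2]) auto
  let ?S = "\<lambda>n. (t / real n) *\<^sub>R (\<Sum>i<n. \<psi> (hadj (F (real i * (t / real n))) y))"
  have char_dyadic: "char_functional P (dyadic_sum F t 1 k) y = exp (?S (2^k))" for k
    using char_functional_riemann_sum[of "t / 2^k" "2^k" "\<lambda>i. F (real i * (t / 2^k))" \<psi> y]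
      F dyadic_point_in_interval[OF t] char t by (simp add: dyadic_sum_def)
  have "filterlim (\<lambda>k::nat. (2::nat)^k) at_top sequentially"
    by (intro filterlim_subseq) (simp add: strict_mono_def)
  then have "filterlim (\<lambda>j. (2::nat)^r j) at_top sequentially"
    using filterlim_compose filterlim_subseq[OF r] by blast
  then have "(\<lambda>j. ?S (2^r j)) \<longlonglongrightarrow> integral {0..t} (\<lambda>s. \<psi> (hadj (F s) y))"
    by (rule filterlim_compose[OF riemann_sums_tendsto_integral[OF t cont]])
  then have "(\<lambda>j. char_functional P (dyadic_sum F t 1 (r j)) y) \<longlonglongrightarrow>
      exp (integral {0..t} (\<lambda>s. \<psi> (hadj (F s) y)))"
    unfolding char_dyadic by (rule tendsto_exp)
  moreover have "(\<lambda>j. char_functional P (dyadic_sum F t 1 (r j)) y) \<longlonglongrightarrow> char_functional P Y y"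
    unfolding char_functional_def
  proof (rule integral_iexp_tendsto)
    show "AE \<omega> in P. (\<lambda>j. inner y (dyadic_sum F t 1 (r j) \<omega>)) \<longlonglongrightarrow> inner y (Y \<omega>)"
      using AE_lim by eventually_elim (intro tendsto_intros)
  qed simp_all
  ultimately show ?thesis by (rule LIMSEQ_unique[rotated])
qed

end

section \<open>Images of Levy exponents under bounded operators\<close>

text \<open>Compensates the change of the truncation function when a jump \<open>x\<close> is mapped to \<open>G x\<close>.\<close>
definition truncation_shift :: "('h \<Rightarrow> 'h) \<Rightarrow> 'h \<Rightarrow> 'h::real_normed_vector" where
  "truncation_shift G x = (indicator {x. norm (G x) < 1} x - indicator {x. norm x < 1} x) *\<^sub>R G x"

lemma min_1_square_le:
  fixes u v C :: real
  assumes "1 \<le> C" "0 \<le> u" "u \<le> C * v"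
  shows "min 1 (u\<^sup>2) \<le> C\<^sup>2 * min 1 (v\<^sup>2)"
proof -
  have "u\<^sup>2 \<le> (C * v)\<^sup>2" using assms by (intro power_mono) auto
  moreover have "1 \<le> C\<^sup>2" using assms by (simp add: one_le_power)
  ultimately show ?thesis by (auto simp: min_def power_mult_distrib)
qed

lemma norm_truncation_shift_le:
  assumes C: "1 \<le> C" and bound: "norm (G x) \<le> C * norm x"
  shows "norm (truncation_shift G x) \<le> C\<^sup>2 * min 1 ((norm x)\<^sup>2)"
proof -
  have C2: "1 \<le> C\<^sup>2" using C by (simp add: one_le_power)
  consider "norm (G x) < 1" "1 \<le> norm x" | "1 \<le> norm (G x)" "norm x < 1"
    | "norm (G x) < 1 \<longleftrightarrow> norm x < 1" by linarith
  then show ?thesis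
  proof cases
    case 1
    then have "min 1 ((norm x)\<^sup>2) = 1" by (simp add: min_def one_le_power)
    then show ?thesis using 1 C2 by (simp add: truncation_shift_def)
  next
    case 2
    then have "norm (G x) \<le> (norm (G x))\<^sup>2" by (simp add: self_le_power)
    also have "\<dots> \<le> C\<^sup>2 * (norm x)\<^sup>2"
      using power_mono[OF bound, of 2] by (simp add: power_mult_distrib)
    finally show ?thesis using 2 by (simp add: truncation_shift_def min_absorb2 power_le_one)
  next
    case 3
    then have "truncation_shift G x = 0" by (simp add: truncation_shift_def indicator_def)
    then show ?thesis by simp
  qed
qed

lemma norm_levy_kernel_image_le:
  assumes "1 \<le> C" "norm (G x) \<le> C * norm x"
  shows "cmod (levy_kernel y (G x)) \<le> ((2 + (norm y)\<^sup>2) * C\<^sup>2) * min 1 ((norm x)\<^sup>2)"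
proof -
  have "(2 + (norm y)\<^sup>2) * min 1 ((norm (G x))\<^sup>2) \<le> (2 + (norm y)\<^sup>2) * (C\<^sup>2 * min 1 ((norm x)\<^sup>2))"
    using assms by (intro mult_left_mono min_1_square_le) auto
  with norm_levy_kernel_le[of y "G x"] show ?thesis by (simp add: mult.assoc)
qed

lemma levy_kernel_hadj:
  fixes G :: "'h::{real_inner,complete_space} \<Rightarrow> 'h"
  assumes "bounded_linear G"
  shows "levy_kernel (hadj G y) x =
    levy_kernel y (G x) + \<i> * complex_of_real (inner (truncation_shift G x) y)"
  by (simp add: levy_kernel_def truncation_shift_def inner_hadj_left[OF assms] inner_commute[of _ y]
      indicator_def)

context levy_measure_space
begin

lemma integrable_truncation_shift:
  fixes G :: "'h \<Rightarrow> 'h"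
  assumes G: "bounded_linear G" and C: "1 \<le> C" "\<And>x. norm (G x) \<le> C * norm x"
  shows "integrable M (truncation_shift G)"
proof (rule integrable_dominated)
  have [measurable]: "G \<in> borel_measurable borel" using G by (rule borel_measurable_bounded_linear)
  show "truncation_shift G \<in> borel_measurable M" unfolding truncation_shift_def[abs_def]
    by measurable
  show "integrable M (\<lambda>x. C\<^sup>2 * min 1 ((norm x)\<^sup>2))" using integrable_min_norm by simp
qed (rule norm_truncation_shift_le[OF C])

lemma integrable_levy_kernel_image:
  fixes G :: "'h \<Rightarrow> 'h"
  assumes G: "bounded_linear G" and C: "1 \<le> C" "\<And>x. norm (G x) \<le> C * norm x"
  shows "integrable M (\<lambda>x. levy_kernel y (G x))"
proof (rule integrable_dominated)
  have [measurable]: "G \<in> borel_measurable borel" using G by (rule borel_measurable_bounded_linear)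
  show "(\<lambda>x. levy_kernel y (G x)) \<in> borel_measurable M" by measurable
  show "integrable M (\<lambda>x. ((2 + (norm y)\<^sup>2) * C\<^sup>2) * min 1 ((norm x)\<^sup>2))" using integrable_min_norm
    by simp
qed (rule norm_levy_kernel_image_le[OF C])

lemma levy_exponent_hadj:
  assumes G: "bounded_linear G" and C: "1 \<le> C" "\<And>x. norm (G x) \<le> C * norm x"
  shows "levy_exponent a \<Theta> M (hadj G y) =
    \<i> * complex_of_real (inner (G a + (LINT x|M. truncation_shift G x)) y)
    - complex_of_real (inner (G (\<Theta> (hadj G y))) y) / 2 + (LINT x|M. levy_kernel y (G x))"
proof -
  note shift = integrable_truncation_shift[OF G C]
  have "(LINT x|M. levy_kernel (hadj G y) x) =
      (LINT x|M. levy_kernel y (G x) + \<i> * complex_of_real (inner (truncation_shift G x) y))"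
    by (simp add: levy_kernel_hadj[OF G])
  also have "\<dots> = (LINT x|M. levy_kernel y (G x))
      + (LINT x|M. \<i> * complex_of_real (inner (truncation_shift G x) y))"
    by (intro Bochner_Integration.integral_add integrable_levy_kernel_image[OF G C]
        integrable_mult_right integrable_of_real integrable_inner_left shift)
  also have "(LINT x|M. \<i> * complex_of_real (inner (truncation_shift G x) y)) =
      \<i> * complex_of_real (inner (LINT x|M. truncation_shift G x) y)"
    by (simp add: shift)
  finally show ?thesis
    by (simp add: levy_exponent_def inner_hadj[OF G] inner_add_left algebra_simps)
qed

end

section \<open>Mixtures of Levy exponents over a family of operators\<close>

locale operator_family = finite_measure T
  for T :: "'s measure" +
  fixes F :: "'s \<Rightarrow> 'h \<Rightarrow> 'h::{real_inner,complete_space,second_countable_topology}" and C :: real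
  assumes bounded_linear_F: "s \<in> space T \<Longrightarrow> bounded_linear (F s)"
    and C_ge_1: "1 \<le> C"
    and norm_F_le: "s \<in> space T \<Longrightarrow> norm (F s x) \<le> C * norm x"
    and measurable_F [measurable]: "(\<lambda>(s, x). F s x) \<in> borel_measurable (T \<Otimes>\<^sub>M borel)"
begin

lemma integrable_bounded:
  fixes f :: "'s \<Rightarrow> 'b::{real_normed_vector,complete_space,second_countable_topology}"
  assumes "f \<in> borel_measurable T" "\<And>s. s \<in> space T \<Longrightarrow> norm (f s) \<le> K"
  shows "integrable T f"
  by (rule integrable_dominated[where g="\<lambda>_. K"]) (simp_all add: assms)

lemma norm_hadj_F_le: "s \<in> space T \<Longrightarrow> norm (hadj (F s) y) \<le> C * norm y"
  by (rule norm_hadj_le[OF bounded_linear_F norm_F_le])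

lemma measurable_hadj_F [measurable]: "(\<lambda>s. hadj (F s) y) \<in> borel_measurable T"
proof (rule borel_measurable_weakI)
  fix z
  have "(\<lambda>s. inner y (F s z)) \<in> borel_measurable T" by measurable
  then show "(\<lambda>s. inner (hadj (F s) y) z) \<in> borel_measurable T"
    by (simp add: inner_hadj_left bounded_linear_F cong: measurable_cong)
qed

lemma integrable_F: "integrable T (\<lambda>s. F s a)"
proof (rule integrable_bounded)
  show "(\<lambda>s. F s a) \<in> borel_measurable T" by measurable
qed (rule norm_F_le)

lemma integrable_F_covariance:
  assumes \<Theta>: "bounded_linear \<Theta>"
  shows "integrable T (\<lambda>s. F s (\<Theta> (hadj (F s) y)))"
proof -
  obtain K where K: "\<And>x. norm (\<Theta> x) \<le> norm x * K" "0 \<le> K"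
    using bounded_linear.nonneg_bounded[OF \<Theta>] by blast
  have [measurable]: "\<Theta> \<in> borel_measurable borel" using \<Theta> by (rule borel_measurable_bounded_linear)
  show ?thesis
  proof (rule integrable_bounded)
    show "(\<lambda>s. F s (\<Theta> (hadj (F s) y))) \<in> borel_measurable T" by measurable
    fix s assume s: "s \<in> space T"
    have "norm (F s (\<Theta> (hadj (F s) y))) \<le> C * norm (\<Theta> (hadj (F s) y))" by (rule norm_F_le[OF s])
    also have "\<dots> \<le> C * (C * norm y * K)"
      using K norm_hadj_F_le[OF s, of y] C_ge_1
      by (intro mult_left_mono order_trans[OF K(1)] mult_right_mono) auto
    finally show "norm (F s (\<Theta> (hadj (F s) y))) \<le> C * (C * norm y * K)" .
  qed
qed

end

locale levy_mixture = operator_family T F C + levy_measure_space M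
  for T :: "'s measure"
    and F :: "'s \<Rightarrow> 'h \<Rightarrow> 'h::{real_inner,complete_space,second_countable_topology}"
    and C and M :: "'h measure"

sublocale levy_mixture \<subseteq> M: sigma_finite_measure M
  by (rule sigma_finite_M)

sublocale levy_mixture \<subseteq> pair_sigma_finite T M ..

context levy_mixture
begin

definition mixture_drift :: "'h \<Rightarrow> 'h" where
  "mixture_drift a = (LINT s|T. F s a) + (LINT s|T. LINT x|M. truncation_shift (F s) x)"

definition mixture_covariance :: "('h \<Rightarrow> 'h) \<Rightarrow> 'h \<Rightarrow> 'h" where
  "mixture_covariance \<Theta> y = (LINT s|T. F s (\<Theta> (hadj (F s) y)))"

text \<open>The density removes the mass that \<open>F\<close> moves to the origin, possibly an infinite one.\<close>
definition mixture_measure :: "'h measure" where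
  "mixture_measure =
    density (distr (T \<Otimes>\<^sub>M M) borel (\<lambda>(s, x). F s x)) (\<lambda>x. ennreal (indicator (- {0}) x))"

lemma measurable_F_pair [measurable]: "(\<lambda>(s, x). F s x) \<in> borel_measurable (T \<Otimes>\<^sub>M M)"
  using measurable_F by (subst measurable_cong_sets[OF sets_pair_measure_cong[OF refl sets_M] refl])

lemma measurable_truncation_shift_F [measurable]:
  "(\<lambda>(s, x). truncation_shift (F s) x) \<in> borel_measurable (T \<Otimes>\<^sub>M M)"
proof -
  have "(\<lambda>(s, x). (indicator {x. norm x < 1} (F s x) - indicator {x. norm x < 1} x) *\<^sub>R F s x)
      \<in> borel_measurable (T \<Otimes>\<^sub>M M)" by measurable
  then show ?thesis by (simp add: truncation_shift_def indicator_def)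
qed

lemma integrable_truncation_shift_F: "s \<in> space T \<Longrightarrow> integrable M (truncation_shift (F s))"
  by (rule integrable_truncation_shift[OF bounded_linear_F C_ge_1 norm_F_le])

lemma integrable_drift_shift: "integrable T (\<lambda>s. LINT x|M. truncation_shift (F s) x)"
proof (rule integrable_bounded)
  show "(\<lambda>s. LINT x|M. truncation_shift (F s) x) \<in> borel_measurable T"
  proof (rule borel_measurable_weakI)
    fix z
    have "(\<lambda>s. LINT x|M. inner (truncation_shift (F s) x) z) \<in> borel_measurable T" by measurable
    then show "(\<lambda>s. inner (LINT x|M. truncation_shift (F s) x) z) \<in> borel_measurable T"
      by (simp add: integrable_truncation_shift_F cong: measurable_cong)
  qed
  show "norm (LINT x|M. truncation_shift (F s) x) \<le> (LINT x|M. C\<^sup>2 * min 1 ((norm x)\<^sup>2))"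
    if "s \<in> space T" for s
    using that integrable_min_norm
    by (intro norm_integral_le_dominated integrable_truncation_shift_F norm_truncation_shift_le
        C_ge_1 norm_F_le) auto
qed

lemma sets_mixture_measure: "sets mixture_measure = sets borel"
  by (simp add: mixture_measure_def)

lemma mixture_measure_zero: "emeasure mixture_measure {0} = 0"
  unfolding mixture_measure_def
  by (subst emeasure_density) (auto intro!: nn_integral_zero' AE_I2 simp: indicator_def)

lemma emeasure_mixture_measure:
  assumes [measurable]: "B \<in> sets borel" and "0 \<notin> B"
  shows "emeasure mixture_measure B = (\<integral>\<^sup>+s. emeasure M {x\<in>space M. F s x \<in> B} \<partial>T)"
proof -
  let ?D = "distr (T \<Otimes>\<^sub>M M) borel (\<lambda>(s, x). F s x)"
  let ?A = "(\<lambda>(s, x). F s x) -` B \<inter> space (T \<Otimes>\<^sub>M M)"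
  have "emeasure mixture_measure B = (\<integral>\<^sup>+x. ennreal (indicator (- {0}) x) * indicator B x \<partial>?D)"
    unfolding mixture_measure_def by (subst emeasure_density) auto
  also have "\<dots> = (\<integral>\<^sup>+x. indicator B x \<partial>?D)"
    using \<open>0 \<notin> B\<close> by (intro nn_integral_cong) (auto simp: indicator_def)
  also have "\<dots> = emeasure (T \<Otimes>\<^sub>M M) ?A" by (simp add: emeasure_distr)
  also have "\<dots> = (\<integral>\<^sup>+s. emeasure M (Pair s -` ?A) \<partial>T)"
    by (rule M.emeasure_pair_measure_alt) (use assms in measurable)
  also have "\<dots> = (\<integral>\<^sup>+s. emeasure M {x\<in>space M. F s x \<in> B} \<partial>T)"
    by (intro nn_integral_cong arg_cong[where f="emeasure M"]) (auto simp: space_pair_measure)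
  finally show ?thesis .
qed

lemma integrable_pair_of_norm_le:
  fixes f :: "'s \<times> 'h \<Rightarrow> complex"
  assumes [measurable]: "f \<in> borel_measurable (T \<Otimes>\<^sub>M M)"
    and bound: "\<And>s x. s \<in> space T \<Longrightarrow> cmod (f (s, x)) \<le> K * min 1 ((norm x)\<^sup>2)"
  shows "integrable (T \<Otimes>\<^sub>M M) f"
proof (rule Fubini_integrable)
  have g: "integrable M (\<lambda>x. K * min 1 ((norm x)\<^sup>2))" using integrable_min_norm by simp
  have slice: "integrable M (\<lambda>x. f (s, x))" if "s \<in> space T" for s
    using g by (rule integrable_dominated[rotated]) (use that bound in auto)
  then show "AE s in T. integrable M (\<lambda>x. f (s, x))" by (rule AE_I2)
  show "integrable T (\<lambda>s. LINT x|M. norm (f (s, x)))"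
  proof (rule integrable_bounded)
    fix s assume s: "s \<in> space T"
    then show "norm (LINT x|M. norm (f (s, x))) \<le> (LINT x|M. K * min 1 ((norm x)\<^sup>2))"
      using bound by (intro norm_integral_le_dominated g integrable_norm slice) auto
  qed measurable
qed measurable

lemma
  fixes f :: "'h \<Rightarrow> complex"
  assumes [measurable]: "f \<in> borel_measurable borel" and "f 0 = 0"
    and bound: "\<And>s x. s \<in> space T \<Longrightarrow> cmod (f (F s x)) \<le> K * min 1 ((norm x)\<^sup>2)"
  shows integral_mixture_measure: "(LINT x|mixture_measure. f x) = (LINT s|T. LINT x|M. f (F s x))"
    and integrable_mixture_section: "integrable T (\<lambda>s. LINT x|M. f (F s x))"
proof -
  let ?D = "distr (T \<Otimes>\<^sub>M M) borel (\<lambda>(s, x). F s x)"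
  have int: "integrable (T \<Otimes>\<^sub>M M) (\<lambda>(s, x). f (F s x))"
    using bound by (intro integrable_pair_of_norm_le) auto
  have "(LINT x|mixture_measure. f x) = (LINT x|?D. indicat_real (- {0}) x *\<^sub>R f x)"
    unfolding mixture_measure_def by (rule integral_density) auto
  also have "\<dots> = (LINT x|?D. f x)"
    using \<open>f 0 = 0\<close> by (intro Bochner_Integration.integral_cong) (auto simp: indicator_def)
  also have "\<dots> = (LINT p|(T \<Otimes>\<^sub>M M). (case p of (s, x) \<Rightarrow> f (F s x)))"
    by (subst integral_distr) (auto simp: case_prod_unfold)
  also have "\<dots> = (LINT s|T. LINT x|M. f (F s x))" using integral_fst'[OF int] by simp
  finally show "(LINT x|mixture_measure. f x) = (LINT s|T. LINT x|M. f (F s x))" .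
  show "integrable T (\<lambda>s. LINT x|M. f (F s x))" using integrable_fst'[OF int] by simp
qed

lemma integral_levy_exponent_hadj:
  assumes \<Theta>: "bounded_linear \<Theta>"
  shows "(LINT s|T. levy_exponent a \<Theta> M (hadj (F s) y)) =
    levy_exponent (mixture_drift a) (mixture_covariance \<Theta>) mixture_measure y"
proof -
  let ?D = "\<lambda>s. F s a + (LINT x|M. truncation_shift (F s) x)"
  let ?Q = "\<lambda>s. F s (\<Theta> (hadj (F s) y))"
  let ?K = "\<lambda>s. LINT x|M. levy_kernel y (F s x)"
  have D: "integrable T ?D"
    by (intro Bochner_Integration.integrable_add integrable_F integrable_drift_shift)
  have Q: "integrable T ?Q" using \<Theta> by (rule integrable_F_covariance)
  have kernel_bound: "cmod (levy_kernel y (F s x)) \<le> ((2 + (norm y)\<^sup>2) * C\<^sup>2) * min 1 ((norm x)\<^sup>2)"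
    if "s \<in> space T" for s x
    using C_ge_1 norm_F_le[OF that] by (rule norm_levy_kernel_image_le)
  note K = integral_mixture_measure[OF levy_kernel_measurable levy_kernel_zero kernel_bound]
    integrable_mixture_section[OF levy_kernel_measurable levy_kernel_zero kernel_bound]
  have "(LINT s|T. levy_exponent a \<Theta> M (hadj (F s) y)) =
      (LINT s|T. \<i> * complex_of_real (inner (?D s) y) - complex_of_real (inner (?Q s) y) / 2
        + ?K s)"
    by (intro Bochner_Integration.integral_cong refl
        levy_exponent_hadj[OF bounded_linear_F C_ge_1 norm_F_le])
  also have "\<dots> = \<i> * complex_of_real (inner (LINT s|T. ?D s) y)
      - complex_of_real (inner (LINT s|T. ?Q s) y) / 2 + (LINT s|T. ?K s)"
    using D Q K(2) by simp
  also have "(LINT s|T. ?D s) = mixture_drift a"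
    unfolding mixture_drift_def
    by (rule Bochner_Integration.integral_add[OF integrable_F integrable_drift_shift])
  finally show ?thesis by (simp add: levy_exponent_def mixture_covariance_def K(1))
qed

end

section \<open>Strongly continuous families\<close>

definition strongly_continuous_family ::
  "'s::topological_space set \<Rightarrow> ('s \<Rightarrow> 'h \<Rightarrow> 'h::real_normed_vector) \<Rightarrow> real \<Rightarrow> bool" where
  "strongly_continuous_family S F C \<longleftrightarrow> 1 \<le> C
    \<and> (\<forall>s\<in>S. bounded_linear (F s) \<and> (\<forall>x. norm (F s x) \<le> C * norm x))
    \<and> (\<forall>x. continuous_on S (\<lambda>s. F s x))"

lemma strongly_continuous_familyD:
  assumes "strongly_continuous_family S F C"
  shows "1 \<le> C" "s \<in> S \<Longrightarrow> bounded_linear (F s)" "s \<in> S \<Longrightarrow> norm (F s x) \<le> C * norm x"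
    "continuous_on S (\<lambda>s. F s x)"
  using assms by (auto simp: strongly_continuous_family_def)

lemma resolvent_family_reflected:
  assumes res: "resolvent_family k A D R" and t: "0 \<le> t"
  obtains C where "strongly_continuous_family {0..t} (\<lambda>s. R (t - s)) C"
proof -
  obtain C where C: "\<And>s x. s \<in> {0..t} \<Longrightarrow> norm (R s x) \<le> C * norm x"
    using res t unfolding resolvent_family_def by meson
  have "strongly_continuous_family {0..t} (\<lambda>s. R (t - s)) (max 1 C)"
    unfolding strongly_continuous_family_def
  proof (intro conjI ballI allI)
    fix s x assume s: "s \<in> {0..t}"
    show "bounded_linear (R (t - s))" using res s by (simp add: resolvent_family_def)
    have "norm (R (t - s) x) \<le> C * norm x" using s by (intro C) auto
    also have "\<dots> \<le> max 1 C * norm x" by (intro mult_right_mono) auto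
    finally show "norm (R (t - s) x) \<le> max 1 C * norm x" .
  next
    fix x
    have "continuous_on {0..} (\<lambda>s. R s x)" using res by (simp add: resolvent_family_def)
    then show "continuous_on {0..t} (\<lambda>s. R (t - s) x)"
      by (rule continuous_on_compose2) (auto intro!: continuous_intros)
  qed simp
  then show thesis by (rule that)
qed

lemma strongly_continuous_family_jointly_continuous:
  fixes F :: "'s::metric_space \<Rightarrow> 'h \<Rightarrow> 'h::real_normed_vector"
  assumes F: "strongly_continuous_family S F C"
  shows "continuous_on (S \<times> UNIV) (\<lambda>(s, x). F s x)"
  unfolding continuous_on_sequentially comp_def
proof (intro allI ballI impI, elim conjE)
  fix u :: "nat \<Rightarrow> 's \<times> 'h" and p
  assume p: "p \<in> S \<times> UNIV" and u: "\<forall>n. u n \<in> S \<times> UNIV" and lim: "u \<longlonglongrightarrow> p"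
  have s: "fst (u n) \<in> S" for n using u[rule_format, of n] by (auto simp: mem_Times_iff)
  have at_limit: "(\<lambda>n. F (fst (u n)) (snd p)) \<longlonglongrightarrow> F (fst p) (snd p)"
    using continuous_on_tendsto_compose[OF strongly_continuous_familyD(4)[OF F] tendsto_fst[OF lim]]
      p s
    by (auto simp: mem_Times_iff)
  have "(\<lambda>n. C * norm (snd (u n) - snd p)) \<longlonglongrightarrow> C * norm (snd p - snd p)"
    by (intro tendsto_intros lim)
  then have "(\<lambda>n. C * norm (snd (u n) - snd p)) \<longlonglongrightarrow> 0" by simp
  then have difference: "(\<lambda>n. F (fst (u n)) (snd (u n) - snd p)) \<longlonglongrightarrow> 0"
    by (rule Lim_null_comparison[rotated]) (use strongly_continuous_familyD(3)[OF F s] in auto)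
  have "F (fst (u n)) (snd (u n)) = F (fst (u n)) (snd (u n) - snd p) + F (fst (u n)) (snd p)" for n
    using linear_diff[OF bounded_linear.linear[OF strongly_continuous_familyD(2)[OF F s]]] by simp
  then have "(\<lambda>n. F (fst (u n)) (snd (u n))) \<longlonglongrightarrow> 0 + F (fst p) (snd p)"
    using tendsto_add[OF difference at_limit] by simp
  then show "(\<lambda>n. case u n of (s, x) \<Rightarrow> F s x) \<longlonglongrightarrow> (case p of (s, x) \<Rightarrow> F s x)"
    by (simp add: case_prod_unfold)
qed

lemma operator_family_strongly_continuous:
  fixes F :: "'s::euclidean_space \<Rightarrow> 'h \<Rightarrow> 'h::{real_inner,complete_space,second_countable_topology}"
  assumes S: "compact S" and F: "strongly_continuous_family S F C"
  shows "operator_family (restrict_space lborel S) F C"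
proof -
  let ?T = "restrict_space lborel S"
  have S_meas [measurable]: "S \<in> sets borel" using S by (simp add: borel_compact)
  have space: "space ?T = S" by (simp add: space_restrict_space)
  have "finite_measure ?T"
    using emeasure_bounded_finite[OF compact_imp_bounded[OF S]]
    by (intro finite_measureI) (simp add: space emeasure_restrict_space)
  moreover have "(\<lambda>(s, x). F s x) \<in> borel_measurable (?T \<Otimes>\<^sub>M borel)"
  proof (subst measurable_cong)
    let ?G = "\<lambda>p. indicator (S \<times> UNIV) p *\<^sub>R (case p of (s, x) \<Rightarrow> F s x)"
    show "(case p of (s, x) \<Rightarrow> F s x) = ?G p" if "p \<in> space (?T \<Otimes>\<^sub>M borel)" for p
      using that by (auto simp: space_pair_measure space)
    have G: "?G \<in> borel_measurable (borel \<Otimes>\<^sub>M borel)"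
      unfolding borel_prod using S_meas strongly_continuous_family_jointly_continuous[OF F]
      by (intro borel_measurable_continuous_on_indicator) (auto intro: borel_Times)
    have "(\<lambda>p. (fst p, snd p)) \<in> ?T \<Otimes>\<^sub>M borel \<rightarrow>\<^sub>M borel \<Otimes>\<^sub>M borel"
      by (intro measurable_Pair measurable_compose[OF measurable_fst] measurable_restrict_space1)
        simp_all
    from measurable_compose[OF this G] show "?G \<in> borel_measurable (?T \<Otimes>\<^sub>M borel)" by simp
  qed
  ultimately show ?thesis
    using strongly_continuous_familyD[OF F]
    by (intro operator_family.intro operator_family_axioms.intro) (auto simp: space)
qed

lemma (in levy_measure_space) continuous_on_levy_exponent_hadj:
  fixes F :: "'s::metric_space \<Rightarrow> 'h \<Rightarrow> 'h"
  assumes F: "strongly_continuous_family S F C"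
    and P: "prob_space P" "X \<in> borel_measurable P" "levy_char P X a \<Theta> M"
  shows "continuous_on S (\<lambda>s. levy_exponent a \<Theta> M (hadj (F s) y))"
  unfolding continuous_on_sequentially comp_def
proof (intro allI ballI impI, elim conjE)
  fix u :: "nat \<Rightarrow> 's" and s
  assume s: "s \<in> S" and u: "\<forall>n. u n \<in> S" and lim: "u \<longlonglongrightarrow> s"
  note F = strongly_continuous_familyD[OF F]
  show "(\<lambda>n. levy_exponent a \<Theta> M (hadj (F (u n)) y)) \<longlonglongrightarrow> levy_exponent a \<Theta> M (hadj (F s) y)"
  proof (rule levy_exponent_weakly_continuous[OF P])
    show "(\<lambda>n. inner (hadj (F (u n)) y) x) \<longlonglongrightarrow> inner (hadj (F s) y) x" for x
      using tendsto_inner[OF tendsto_const continuous_on_tendsto_compose[OF F(4) lim s], of y x] u s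
      by (simp add: inner_hadj_left F(2))
    show "norm (hadj (F (u n)) y) \<le> C * norm y" for n using u F(2,3) by (intro norm_hadj_le) auto
  qed
qed

lemma integral_restrict_space_lborel_continuous:
  fixes f :: "real \<Rightarrow> 'b::euclidean_space"
  assumes "continuous_on {a..b} f"
  shows "(LINT s|restrict_space lborel {a..b}. f s) = integral {a..b} f"
proof -
  have "set_integrable lborel {a..b} f"
    unfolding set_integrable_def by (rule borel_integrable_compact[OF compact_Icc assms])
  from set_borel_integral_eq_integral(2)[OF this] show ?thesis
    by (simp add: integral_restrict_space set_lebesgue_integral_def)
qed

section \<open>The characteristics of the stochastic convolution\<close>

lemma (in levy_process_space) char_functional_levy_convolution:
  assumes t: "0 \<le> t" and F: "strongly_continuous_family {0..t} F C" and M: "levy_measure M"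
    and Z: "\<And>s. 0 \<le> s \<Longrightarrow> levy_char P (Z s) (s *\<^sub>R a) (\<lambda>y. s *\<^sub>R \<Theta> y) (scale_measure (ennreal s) M)"
    and Y: "Y \<in> borel_measurable P" and lim: "tendsto_in_prob P (dyadic_sum F t 1) Y"
  shows "char_functional P Y y =
    exp (LINT s|restrict_space lborel {0..t}. levy_exponent a \<Theta> M (hadj (F s) y))"
proof -
  interpret levy_measure_space M using M by (rule levy_measure_space.intro)
  have cont: "continuous_on {0..t} (\<lambda>s. levy_exponent a \<Theta> M (hadj (F s) y))"
  proof (rule continuous_on_levy_exponent_hadj[OF F prob_space_axioms])
    show "Z 1 \<in> borel_measurable P" by (rule Z_measurable) simp
    show "levy_char P (Z 1) a \<Theta> M" using Z[of 1] by simp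
  qed
  have "char_functional P Y y = exp (integral {0..t} (\<lambda>s. levy_exponent a \<Theta> M (hadj (F s) y)))"
  proof (rule char_functional_of_dyadic_limit[OF t _ Y lim _ cont])
    show "bounded_linear (F s)" if "s \<in> {0..t}" for s
      using F that by (rule strongly_continuous_familyD)
    show "char_functional P (Z s) y = exp (complex_of_real s * levy_exponent a \<Theta> M y)"
      if "0 \<le> s" for s y
      using Z[OF that] levy_exponent_scale[OF that sets_M] by (simp add: levy_char_iff)
  qed
  then show ?thesis by (simp add: integral_restrict_space_lborel_continuous[OF cont])
qed

theorem theorem4:
  fixes P :: "'w measure"
    and Z :: "real \<Rightarrow> 'w \<Rightarrow> 'h::{real_inner,complete_space,second_countable_topology}"
    and a :: 'h and \<Theta> :: "'h \<Rightarrow> 'h" and M :: "'h measure"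
    and k :: "real \<Rightarrow> real" and A :: "'h \<Rightarrow> 'h" and D :: "'h set"
    and R :: "real \<Rightarrow> 'h \<Rightarrow> 'h"
  assumes lp: "levy_process P Z"
    and Theta: "nonneg_sym_trace_class \<Theta>"
    and LM: "levy_measure M"
    and Zchar: "\<And>t. t \<ge> 0 \<Longrightarrow> infinitely_divisible P (Z t)
                 \<and> levy_char P (Z t) (t *\<^sub>R a) (\<lambda>y. t *\<^sub>R \<Theta> y) (scale_measure (ennreal t) M)"
    and A: "closed_dense_op A D"
    and kernel: "\<And>T. T \<ge> 0 \<Longrightarrow> set_integrable lborel {0..T} k"
    and res: "resolvent_family k A D R"
    and t: "t \<ge> 0"
    and Ymeas: "Y \<in> borel_measurable P"
    and Yconv: "is_stoch_conv P R Z t Y"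
  shows "infinitely_divisible P Y \<and>
    (\<exists>MM. sets MM = sets borel \<and> emeasure MM {0} = 0
      \<and> (\<forall>B\<in>sets borel. 0 \<notin> B \<longrightarrow>
           emeasure MM B = (\<integral>\<^sup>+s\<in>{0..t}. emeasure M {x\<in>space M. R (t - s) x \<in> B} \<partial>lborel))
      \<and> levy_char P Y
          ((LINT s:{0..t}|lborel. R (t - s) a)
           + (LINT s:{0..t}|lborel. (LINT x|M.
                (indicator {x. norm (R (t - s) x) < 1} x - indicator {x. norm x < 1} x) *\<^sub>R R (t - s) x)))
          (\<lambda>y. LINT s:{0..t}|lborel. R (t - s) (\<Theta> (hadj (R (t - s)) y)))
          MM)"
proof -
  interpret levy_process_space P Z using lp by (rule levy_process_space.intro)
  obtain C where F: "strongly_continuous_family {0..t} (\<lambda>s. R (t - s)) C"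
    using res t by (rule resolvent_family_reflected)
  interpret levy_mixture "restrict_space lborel {0..t}" "\<lambda>s. R (t - s)" C M
    by (intro levy_mixture.intro operator_family_strongly_continuous compact_Icc F
        levy_measure_space.intro LM)
  have \<Theta>: "bounded_linear \<Theta>" using Theta by (simp add: nonneg_sym_trace_class_def)
  have "bounded_linear (R 0)" using res by (simp add: resolvent_family_def)
  then have lim: "tendsto_in_prob P (dyadic_sum (\<lambda>s. R (t - s)) t 1) Y"
    using t Ymeas Yconv by (intro dyadic_sum_tendsto_stoch_conv)
  have "levy_char P Y (mixture_drift a) (mixture_covariance \<Theta>) mixture_measure"
    unfolding levy_char_iff integral_levy_exponent_hadj[OF \<Theta>, symmetric]
    using char_functional_levy_convolution[OF t F LM _ Ymeas lim] Zchar by blast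
  moreover have "infinitely_divisible P Y"
    using t strongly_continuous_familyD(2)[OF F] Ymeas lim
    by (rule infinitely_divisible_of_dyadic_limit)
  ultimately show ?thesis
    using sets_mixture_measure mixture_measure_zero emeasure_mixture_measure
      integrable_F integrable_drift_shift integrable_F_covariance[OF \<Theta>]
    by (intro conjI exI[of _ mixture_measure])
       (auto simp: mixture_drift_def mixture_covariance_def[abs_def] truncation_shift_def
          nn_integral_restrict_space integral_restrict_space_complete)
qed

end
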